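(* Let $0<r<1$ and let $T$ be an invertible bounded operator on a complex Hilbert space $\mathcal H$. Then $T\in C_{1,r}$ if and only if there is an invertible operator $J$ on a Hilbert space $\mathcal K\supseteq\mathcal H$ such that $T^n=P_{\mathcal H}J^n|_{\mathcal H}$ for every $n\in\mathbb Z$ and $J$ admits the form $$J=U\begin{bmatrix} rI_{\mathcal K_0}&0\\0&I_{\mathcal K_1}\end{bmatrix},$$ where $U$ is a unitary on $\mathcal K$ and $\mathcal K=\mathcal K_0\oplus\mathcal K_1$ is an orthogonal decomposition.
   Context: All operators are bounded linear operators on complex Hilbert spaces. $C_{1,r}$ is the class of invertible operators $T$ with $\|T\|\le1$ and $\|rT^{-1}\|\le1$. $P_{\mathcal H}$ is the orthogonal projection of $\mathcal K$ onto $\mathcal H$; the containment $\mathcal K\supseteq\mathcal H$ is up to isometric embedding of $\mathcal H$ as a closed subspace. The summands $\mathcal K_0,\mathcal K_1$ are closed subspaces, possibly $\{0\}$. *)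

theory Defs
  imports "HOL-Analysis.Analysis"
begin

section \<open>Complex Hilbert spaces\<close>

text \<open>
  A complex Hilbert space is a complete real inner product space with a compatible complex
  scalar multiplication and a sesquilinear form, linear in the first argument, whose real part is
  the real inner product. Norm, topology, completeness and \<^const>\<open>onorm\<close> are thereby
  those of the library: \<open>norm x ^ 2 = Re (cinner x x)\<close>, and \<open>cinner x x\<close> is real by
  conjugate symmetry.
\<close>

class complex_vector = real_vector +
  fixes scaleC :: "complex \<Rightarrow> 'a \<Rightarrow> 'a" (infixr \<open>*\<^sub>C\<close> 75)
  assumes scaleC_add_right: "a *\<^sub>C (x + y) = a *\<^sub>C x + a *\<^sub>C y"
    and scaleC_add_left: "(a + b) *\<^sub>C x = a *\<^sub>C x + b *\<^sub>C x"
    and scaleC_scaleC: "a *\<^sub>C (b *\<^sub>C x) = (a * b) *\<^sub>C x"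
    and scaleR_scaleC: "t *\<^sub>R x = complex_of_real t *\<^sub>C x"

class complex_inner = complex_vector + real_inner +
  fixes cinner :: "'a \<Rightarrow> 'a \<Rightarrow> complex"
  assumes cinner_commute: "cinner x y = cnj (cinner y x)"
    and cinner_add_left: "cinner (x + y) z = cinner x z + cinner y z"
    and cinner_scaleC_left: "cinner (a *\<^sub>C x) y = a * cinner x y"
    and inner_Re_cinner: "inner x y = Re (cinner x y)"

class complex_hilbert = complex_inner + complete_space

instantiation complex :: complex_hilbert
begin

definition scaleC_complex_def: "a *\<^sub>C (z :: complex) = a * z"
definition cinner_complex_def: "cinner (z :: complex) w = z * cnj w"

instance
  by standard
    (auto simp: scaleC_complex_def cinner_complex_def algebra_simps scaleR_conv_of_real
      inner_complex_def)

end

definition csubspace :: "'a :: complex_vector set \<Rightarrow> bool" where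
  "csubspace M \<longleftrightarrow> 0 \<in> M \<and> (\<forall>x\<in>M. \<forall>y\<in>M. x + y \<in> M) \<and> (\<forall>a. \<forall>x\<in>M. a *\<^sub>C x \<in> M)"

definition orth_proj :: "'a :: complex_inner set \<Rightarrow> 'a \<Rightarrow> 'a" where
  "orth_proj M x = (THE y. y \<in> M \<and> (\<forall>z\<in>M. cinner (x - y) z = 0))"


section \<open>Operators\<close>

definition bounded_clinear :: "('a :: complex_inner \<Rightarrow> 'b :: complex_inner) \<Rightarrow> bool" where
  "bounded_clinear A \<longleftrightarrow> bounded_linear A \<and> (\<forall>a x. A (a *\<^sub>C x) = a *\<^sub>C A x)"

definition invertible_op :: "('a :: complex_inner \<Rightarrow> 'a) \<Rightarrow> bool" where
  "invertible_op A \<longleftrightarrow> bounded_clinear A \<and> (\<exists>B. bounded_clinear B \<and> A \<circ> B = id \<and> B \<circ> A = id)"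

definition op_powi :: "('a \<Rightarrow> 'a) \<Rightarrow> int \<Rightarrow> 'a \<Rightarrow> 'a" where
  "op_powi A n = (if 0 \<le> n then A ^^ nat n else inv A ^^ nat (- n))"

definition isometric_embedding :: "('a :: complex_inner \<Rightarrow> 'b :: complex_inner) \<Rightarrow> bool" where
  "isometric_embedding V \<longleftrightarrow> bounded_clinear V \<and> (\<forall>x y. cinner (V x) (V y) = cinner x y)"

definition unitary_op :: "('a :: complex_inner \<Rightarrow> 'a) \<Rightarrow> bool" where
  "unitary_op U \<longleftrightarrow> isometric_embedding U \<and> surj U"

definition class_C1 :: "real \<Rightarrow> ('a :: complex_inner \<Rightarrow> 'a) set" where
  "class_C1 r = {A. invertible_op A \<and> onorm A \<le> 1 \<and> onorm (\<lambda>x. r *\<^sub>R inv A x) \<le> 1}"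

definition orth_decomp :: "'a :: complex_inner set \<Rightarrow> 'a set \<Rightarrow> bool" where
  "orth_decomp K0 K1 \<longleftrightarrow>
     csubspace K0 \<and> closed K0 \<and> csubspace K1 \<and> closed K1 \<and>
     (\<forall>x\<in>K0. \<forall>y\<in>K1. cinner x y = 0) \<and> (\<forall>z. \<exists>x\<in>K0. \<exists>y\<in>K1. z = x + y)"

text \<open>The block matrix \<open>diag (a I, b I)\<close> with respect to the decomposition \<open>K0 \<oplus> K1\<close>.\<close>

definition diag_op :: "'a :: complex_inner set \<Rightarrow> 'a set \<Rightarrow> real \<Rightarrow> real \<Rightarrow> 'a \<Rightarrow> 'a" where
  "diag_op K0 K1 a b z = a *\<^sub>R orth_proj K0 z + b *\<^sub>R orth_proj K1 z"

text \<open>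
  \<open>'b\<close> is regarded as containing \<open>'a\<close> by means of \<open>V\<close>; thus \<open>T^n = P J^n |\<close> becomes
  \<open>V T^n = P J^n V\<close> with \<open>P\<close> the projection onto the range of \<open>V\<close>.
\<close>

definition power_dilation ::
  "('a :: complex_inner \<Rightarrow> 'b :: complex_inner) \<Rightarrow> ('b \<Rightarrow> 'b) \<Rightarrow> ('a \<Rightarrow> 'a) \<Rightarrow> bool" where
  "power_dilation V J T \<longleftrightarrow>
     isometric_embedding V \<and> invertible_op J \<and>
     (\<forall>n x. V (op_powi T n x) = orth_proj (range V) (op_powi J n (V x)))"

definition unitary_diag_form :: "real \<Rightarrow> ('b :: complex_inner \<Rightarrow> 'b) \<Rightarrow> bool" where
  "unitary_diag_form r J \<longleftrightarrow>
     (\<exists>U K0 K1. unitary_op U \<and> orth_decomp K0 K1 \<and> J = U \<circ> diag_op K0 K1 r 1)"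


section \<open>The orthogonal projection is well defined\<close>

lemma csubspace_scaleR: "csubspace M \<Longrightarrow> x \<in> M \<Longrightarrow> t *\<^sub>R x \<in> M"
  by (simp add: csubspace_def scaleR_scaleC)

lemma csubspace_diff: "csubspace M \<Longrightarrow> x \<in> M \<Longrightarrow> y \<in> M \<Longrightarrow> x - y \<in> M"
  using csubspace_scaleR[of M y "-1"] by (metis csubspace_def diff_conv_add_uminus scaleR_minus1_left)

lemma orthogonal_nearest:
  fixes M :: "'a :: complex_inner set"
  assumes M: "csubspace M" and y: "y \<in> M" and z: "z \<in> M"
    and min: "\<And>w. w \<in> M \<Longrightarrow> norm (x - y) \<le> norm (x - w)"
  shows "inner (x - y) z = 0"
proof (cases "z = 0")
  case False
  define t where "t = inner (x - y) z / inner z z"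
  have zz: "inner z z > 0" using False by (simp add: inner_gt_zero_iff)
  have "y + t *\<^sub>R z \<in> M" using M y csubspace_scaleR[OF M z] by (auto simp: csubspace_def)
  then have "norm (x - y) \<le> norm ((x - y) - t *\<^sub>R z)" using min[of "y + t *\<^sub>R z"]
    by (simp add: algebra_simps)
  then have "(norm (x - y))\<^sup>2 \<le> (norm ((x - y) - t *\<^sub>R z))\<^sup>2" by (simp add: power_mono)
  also have "\<dots> = (norm (x - y))\<^sup>2 - 2 * t * inner (x - y) z + t\<^sup>2 * inner z z"
    unfolding power2_norm_eq_inner inner_diff_left[of "x - y" "t *\<^sub>R z"]
      inner_diff_right[of _ "x - y" "t *\<^sub>R z"]
    by (simp add: inner_commute[of z x] inner_commute[of z y] power2_eq_square algebra_simps)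
  finally have "2 * t * inner (x - y) z \<le> t\<^sup>2 * inner z z" by simp
  moreover have tz: "inner (x - y) z = t * inner z z" using zz by (simp add: t_def)
  ultimately have "t * (t * inner z z) \<le> 0"
    unfolding tz by (simp add: power2_eq_square mult.assoc)
  then have "t * t \<le> 0" using zz by (metis mult.assoc mult_le_0_iff not_le)
  then have "t = 0" by (metis antisym mult_eq_0_iff zero_le_square)
  then show ?thesis using zz by (simp add: t_def)
qed simp

lemma orth_proj_unique:
  fixes M :: "'a :: complex_inner set"
  assumes M: "csubspace M"
    and y: "y \<in> M" "\<And>z. z \<in> M \<Longrightarrow> cinner (x - y) z = 0"
  shows "orth_proj M x = y"
  unfolding orth_proj_def
proof (rule the_equality)
  fix w assume w: "w \<in> M \<and> (\<forall>z\<in>M. cinner (x - w) z = 0)"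
  have "w - y \<in> M" using csubspace_diff[OF M] w y by blast
  then have "inner (x - y) (w - y) = 0" "inner (x - w) (w - y) = 0"
    using w y by (auto simp: inner_Re_cinner)
  then have "inner (w - y) (w - y) = 0" by (simp add: algebra_simps)
  then show "w = y" by simp
qed (use y in blast)

lemma nearest_point_exists:
  fixes M :: "'a :: complex_hilbert set"
  assumes M: "csubspace M" and cl: "closed M"
  shows "\<exists>y\<in>M. \<forall>w\<in>M. norm (x - y) \<le> norm (x - w)"
proof -
  have ne: "M \<noteq> {}" using M by (auto simp: csubspace_def)
  define d where "d = infdist x M"
  have d0: "0 \<le> d" by (simp add: d_def infdist_nonneg)
  have dle: "d \<le> norm (x - w)" if "w \<in> M" for w
    using infdist_le[OF that, of x] by (simp add: d_def dist_norm)
  have "\<exists>y\<in>M. norm (x - y) < d + 1 / Suc n" for n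
  proof (rule ccontr)
    assume "\<not> ?thesis"
    then have "d + 1 / Suc n \<le> dist x y" if "y \<in> M" for y
      using that by (auto simp: dist_norm not_less)
    then have "d + 1 / Suc n \<le> infdist x M"
      unfolding infdist_notempty[OF ne] by (intro cINF_greatest ne)
    then show False by (simp add: d_def)
  qed
  then obtain f where f: "\<And>n. f n \<in> M" "\<And>n. norm (x - f n) < d + 1 / Suc n" by metis
  have lim: "(\<lambda>n. 1 / real (Suc n)) \<longlonglongrightarrow> 0"
    using LIMSEQ_inverse_real_of_nat by (simp add: inverse_eq_divide)
  have par: "(norm (f m - f n))\<^sup>2 \<le> 2 * ((d + 1 / Suc m)\<^sup>2 - d\<^sup>2) + 2 * ((d + 1 / Suc n)\<^sup>2 - d\<^sup>2)"
    for m n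
  proof -
    have "(1/2) *\<^sub>R (f m + f n) \<in> M"
      using M f by (intro csubspace_scaleR) (auto simp: csubspace_def)
    from dle[OF this] have "d\<^sup>2 \<le> (norm (x - (1/2) *\<^sub>R (f m + f n)))\<^sup>2" using d0
      by (simp add: power_mono)
    moreover have "(norm (f m - f n))\<^sup>2 = 2 * (norm (x - f m))\<^sup>2 + 2 * (norm (x - f n))\<^sup>2
        - 4 * (norm (x - (1/2) *\<^sub>R (f m + f n)))\<^sup>2"
      unfolding power2_norm_eq_inner
      by (simp add: algebra_simps inner_commute)
    moreover have "(norm (x - f m))\<^sup>2 \<le> (d + 1 / Suc m)\<^sup>2" "(norm (x - f n))\<^sup>2 \<le> (d + 1 / Suc n)\<^sup>2"
      using f(2)[THEN less_imp_le] by (auto intro!: power_mono simp del: of_nat_Suc)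
    ultimately show ?thesis by argo
  qed
  have "Cauchy f"
  proof (rule metric_CauchyI)
    fix e :: real assume e: "0 < e"
    have "(\<lambda>n. (d + 1 / Suc n)\<^sup>2 - d\<^sup>2) \<longlonglongrightarrow> (d + 0)\<^sup>2 - d\<^sup>2"
      by (intro tendsto_intros lim)
    then have "(\<lambda>n. (d + 1 / Suc n)\<^sup>2 - d\<^sup>2) \<longlonglongrightarrow> 0" by simp
    then have "eventually (\<lambda>n. (d + 1 / Suc n)\<^sup>2 - d\<^sup>2 < e\<^sup>2 / 4) sequentially"
      by (rule order_tendstoD) (use e in simp)
    then obtain N where N: "\<And>n. n \<ge> N \<Longrightarrow> (d + 1 / Suc n)\<^sup>2 - d\<^sup>2 < e\<^sup>2 / 4"
      by (auto simp: eventually_sequentially)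
    have "dist (f m) (f n) < e" if "m \<ge> N" "n \<ge> N" for m n
    proof -
      have "(norm (f m - f n))\<^sup>2 < e\<^sup>2" using par[of m n] N[OF that(1)] N[OF that(2)] by argo
      then show ?thesis using e by (simp add: dist_norm power_less_imp_less_base)
    qed
    then show "\<exists>N. \<forall>m\<ge>N. \<forall>n\<ge>N. dist (f m) (f n) < e" by blast
  qed
  then obtain y where y: "f \<longlonglongrightarrow> y" using Cauchy_convergent convergentD by blast
  have yM: "y \<in> M" using closed_sequentially[OF cl f(1) y] .
  have "(\<lambda>n. norm (x - f n)) \<longlonglongrightarrow> norm (x - y)" by (intro tendsto_intros y)
  moreover have "(\<lambda>n. d + 1 / Suc n) \<longlonglongrightarrow> d + 0" by (intro tendsto_intros lim)
  ultimately have "norm (x - y) \<le> d + 0" by (rule LIMSEQ_le) (use f(2) less_imp_le in blast)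
  then show ?thesis using yM dle by force
qed

lemma orth_proj:
  fixes M :: "'a :: complex_hilbert set"
  assumes M: "csubspace M" and cl: "closed M"
  shows orth_proj_in: "orth_proj M x \<in> M"
    and orth_proj_orthogonal: "z \<in> M \<Longrightarrow> cinner (x - orth_proj M x) z = 0"
proof -
  obtain y where y: "y \<in> M" and min: "\<And>w. w \<in> M \<Longrightarrow> norm (x - y) \<le> norm (x - w)"
    using nearest_point_exists[OF M cl] by blast
  have orth: "cinner (x - y) z = 0" if z: "z \<in> M" for z
  proof -
    have "\<i> *\<^sub>C z \<in> M" using M z by (simp add: csubspace_def)
    then have "inner (x - y) (\<i> *\<^sub>C z) = 0" "inner (x - y) z = 0"
      using orthogonal_nearest[OF M y _ min] z by auto
    moreover have "cinner (x - y) (\<i> *\<^sub>C z) = - \<i> * cinner (x - y) z"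
      by (metis cinner_commute cinner_scaleC_left complex_cnj_i complex_cnj_mult)
    ultimately show ?thesis by (simp add: inner_Re_cinner complex_eq_iff)
  qed
  have "orth_proj M x = y" by (rule orth_proj_unique[OF M y orth])
  then show "orth_proj M x \<in> M" "z \<in> M \<Longrightarrow> cinner (x - orth_proj M x) z = 0"
    using y orth by auto
qed


section \<open>The Hilbert space of square-summable sequences in a Hilbert space\<close>

text \<open>
  Types cannot be quantified existentially, so this space serves as a universe for dilation spaces
  of operators on \<open>'a\<close>, and is large enough. Given \<open>J = U diag (r I, I)\<close> on some \<open>K\<close>
  containing \<open>'a\<close>, the smallest closed subspace \<open>K'\<close> containing \<open>'a\<close> and reducing \<open>U\<close>
  and the projections onto the summands still carries a dilation of the same form. It has
  Hilbert dimension at most \<open>aleph_0\<close> times that of \<open>'a\<close>, hence embeds in \<open>'a ell2\<close>;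
  on the orthogonal complement one takes \<open>J = U = I\<close> and enlarges the second summand.
\<close>

typedef (overloaded) 'a ell2 = "{f :: nat \<Rightarrow> 'a :: complex_inner. summable (\<lambda>n. (norm (f n))\<^sup>2)}"
  morphisms ell2_nth Abs_ell2
  by (rule exI[of _ "\<lambda>_. 0"]) simp

setup_lifting type_definition_ell2

lemma square_summable_add:
  fixes f g :: "nat \<Rightarrow> 'a :: complex_inner"
  assumes "summable (\<lambda>n. (norm (f n))\<^sup>2)" "summable (\<lambda>n. (norm (g n))\<^sup>2)"
  shows "summable (\<lambda>n. (norm (f n + g n))\<^sup>2)"
proof (rule summable_comparison_test')
  show "summable (\<lambda>n. 2 * (norm (f n))\<^sup>2 + 2 * (norm (g n))\<^sup>2)"
    by (intro summable_add summable_mult assms)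
  fix n
  have "(norm (f n + g n))\<^sup>2 \<le> (norm (f n) + norm (g n))\<^sup>2"
    by (intro power_mono norm_triangle_ineq) simp
  also have "\<dots> \<le> 2 * (norm (f n))\<^sup>2 + 2 * (norm (g n))\<^sup>2"
    using zero_le_power2[of "norm (f n) - norm (g n)"] by (simp add: power2_eq_square algebra_simps)
  finally show "norm ((norm (f n + g n))\<^sup>2) \<le> 2 * (norm (f n))\<^sup>2 + 2 * (norm (g n))\<^sup>2" by simp
qed

lemma cinner_self: "cinner x x = complex_of_real ((norm x)\<^sup>2)"
proof -
  have "Im (cinner x x) = 0" using cinner_commute[of x x] by (metis cnj.simps(2) neg_equal_zero)
  then show ?thesis by (simp add: complex_eq_iff power2_norm_eq_inner inner_Re_cinner)
qed

lemma norm_scaleC: "norm (a *\<^sub>C (x :: 'a :: complex_inner)) = cmod a * norm x"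
proof -
  have "cinner (a *\<^sub>C x) (a *\<^sub>C x) = a * cnj a * cinner x x"
    by (metis cinner_commute cinner_scaleC_left complex_cnj_mult mult.assoc)
  then have "complex_of_real ((norm (a *\<^sub>C x))\<^sup>2) = complex_of_real ((cmod a * norm x)\<^sup>2)"
    by (simp add: cinner_self complex_norm_square power_mult_distrib del: of_real_power)
  then show ?thesis by (metis norm_ge_zero of_real_eq_iff power2_eq_iff_nonneg zero_le_mult_iff)
qed

lemma cinner_norm_le: "cmod (cinner x y) \<le> norm x * norm y"
proof (cases "cinner x y = 0")
  case False
  define a where "a = cnj (cinner x y) / complex_of_real (cmod (cinner x y))"
  have a1: "cmod a = 1" using False by (simp add: a_def norm_divide)
  have "a * cinner x y = complex_of_real (cmod (cinner x y))"
    using False by (simp add: a_def complex_norm_square[symmetric] mult.commute power2_eq_square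
        del: complex_mult_cnj)
  then have "cmod (cinner x y) = inner (a *\<^sub>C x) y"
    by (simp add: inner_Re_cinner cinner_scaleC_left)
  also have "\<dots> \<le> norm (a *\<^sub>C x) * norm y" by (rule norm_cauchy_schwarz)
  finally show ?thesis by (simp add: norm_scaleC a1)
qed simp

lemma summable_norm_prod:
  fixes f g :: "nat \<Rightarrow> 'a :: complex_inner"
  assumes "summable (\<lambda>n. (norm (f n))\<^sup>2)" "summable (\<lambda>n. (norm (g n))\<^sup>2)"
  shows "summable (\<lambda>n. norm (f n) * norm (g n))"
proof (rule summable_comparison_test')
  show "summable (\<lambda>n. (norm (f n))\<^sup>2 + (norm (g n))\<^sup>2)" by (intro summable_add assms)
  fix n
  have "2 * (norm (f n) * norm (g n)) \<le> (norm (f n))\<^sup>2 + (norm (g n))\<^sup>2"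
    using zero_le_power2[of "norm (f n) - norm (g n)"] by (simp add: power2_eq_square algebra_simps)
  moreover have "0 \<le> norm (f n) * norm (g n)" by simp
  ultimately have "norm (f n) * norm (g n) \<le> (norm (f n))\<^sup>2 + (norm (g n))\<^sup>2" by linarith
  then show "norm (norm (f n) * norm (g n)) \<le> (norm (f n))\<^sup>2 + (norm (g n))\<^sup>2"
    by (simp add: abs_mult)
qed

lemma ell2_summable: "summable (\<lambda>n. (norm (ell2_nth x n))\<^sup>2)"
  using ell2_nth[of x] by simp

lemma summable_cinner_ell2: "summable (\<lambda>n. cinner (ell2_nth x n) (ell2_nth y n))"
  by (rule summable_comparison_test'[OF summable_norm_prod[OF ell2_summable ell2_summable]])
    (rule cinner_norm_le)

lemma summable_inner_ell2: "summable (\<lambda>n. inner (ell2_nth x n) (ell2_nth y n))"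
  unfolding inner_Re_cinner by (intro summable_Re summable_cinner_ell2)

instantiation ell2 :: (complex_inner) complex_inner
begin

lift_definition zero_ell2 :: "'a ell2" is "\<lambda>_. 0" by simp
lift_definition plus_ell2 :: "'a ell2 \<Rightarrow> 'a ell2 \<Rightarrow> 'a ell2" is "\<lambda>f g n. f n + g n"
  by (rule square_summable_add)
lift_definition uminus_ell2 :: "'a ell2 \<Rightarrow> 'a ell2" is "\<lambda>f n. - f n" by simp
lift_definition minus_ell2 :: "'a ell2 \<Rightarrow> 'a ell2 \<Rightarrow> 'a ell2" is "\<lambda>f g n. f n - g n"
proof -
  fix f g :: "nat \<Rightarrow> 'a"
  assume "summable (\<lambda>n. (norm (f n))\<^sup>2)" "summable (\<lambda>n. (norm (g n))\<^sup>2)"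
  then show "summable (\<lambda>n. (norm (f n - g n))\<^sup>2)"
    using square_summable_add[of f "\<lambda>n. - g n"] by simp
qed
lift_definition scaleR_ell2 :: "real \<Rightarrow> 'a ell2 \<Rightarrow> 'a ell2" is "\<lambda>t f n. t *\<^sub>R f n"
  by (simp add: power_mult_distrib summable_mult)
lift_definition scaleC_ell2 :: "complex \<Rightarrow> 'a ell2 \<Rightarrow> 'a ell2" is "\<lambda>a f n. a *\<^sub>C f n"
  by (simp add: norm_scaleC power_mult_distrib summable_mult)

definition cinner_ell2 :: "'a ell2 \<Rightarrow> 'a ell2 \<Rightarrow> complex" where
  "cinner_ell2 x y = (\<Sum>n. cinner (ell2_nth x n) (ell2_nth y n))"
definition inner_ell2 :: "'a ell2 \<Rightarrow> 'a ell2 \<Rightarrow> real" where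
  "inner_ell2 x y = (\<Sum>n. inner (ell2_nth x n) (ell2_nth y n))"
definition norm_ell2 :: "'a ell2 \<Rightarrow> real" where
  "norm_ell2 x = sqrt (inner x x)"
definition dist_ell2 :: "'a ell2 \<Rightarrow> 'a ell2 \<Rightarrow> real" where
  "dist_ell2 x y = norm (x - y)"
definition sgn_ell2 :: "'a ell2 \<Rightarrow> 'a ell2" where
  "sgn_ell2 x = inverse (norm x) *\<^sub>R x"
definition uniformity_ell2 :: "('a ell2 \<times> 'a ell2) filter" where
  "uniformity_ell2 = (INF e\<in>{0 <..}. principal {(x, y). dist x y < e})"
definition open_ell2 :: "'a ell2 set \<Rightarrow> bool" where
  "open_ell2 U \<longleftrightarrow> (\<forall>x\<in>U. eventually (\<lambda>(x', y). x' = x \<longrightarrow> y \<in> U) uniformity)"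

instance
proof
  fix x y z :: "'a ell2" and a b :: complex and s t :: real
  note nth = plus_ell2.rep_eq scaleR_ell2.rep_eq scaleC_ell2.rep_eq zero_ell2.rep_eq
  show "x + y + z = x + (y + z)" "x + y = y + x" "0 + x = x" "- x + x = 0" "x - y = x + - y"
    by (transfer; simp add: algebra_simps)+
  show "t *\<^sub>R (x + y) = t *\<^sub>R x + t *\<^sub>R y" "(s + t) *\<^sub>R x = s *\<^sub>R x + t *\<^sub>R x"
    "s *\<^sub>R t *\<^sub>R x = (s * t) *\<^sub>R x" "1 *\<^sub>R x = x"
    by (transfer; simp add: algebra_simps)+
  show "a *\<^sub>C (x + y) = a *\<^sub>C x + a *\<^sub>C y" "(a + b) *\<^sub>C x = a *\<^sub>C x + b *\<^sub>C x"
    "a *\<^sub>C b *\<^sub>C x = (a * b) *\<^sub>C x"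
    by (transfer; simp add: scaleC_add_right scaleC_add_left scaleC_scaleC)+
  show "t *\<^sub>R x = complex_of_real t *\<^sub>C x" by (transfer; simp add: scaleR_scaleC)
  show "sgn x = inverse (norm x) *\<^sub>R x" "dist x y = norm (x - y)" "norm x = sqrt (inner x x)"
    by (rule sgn_ell2_def dist_ell2_def norm_ell2_def)+
  show "uniformity = (INF e\<in>{0 <..}. principal {(x, y :: 'a ell2). dist x y < e})"
    by (rule uniformity_ell2_def)
  show "open U \<longleftrightarrow> (\<forall>x\<in>U. eventually (\<lambda>(x', y). x' = x \<longrightarrow> y \<in> U) uniformity)" for U :: "'a ell2 set"
    by (rule open_ell2_def)
  show "inner x y = inner y x" by (simp add: inner_ell2_def inner_commute)
  show "inner (x + y) z = inner x z + inner y z"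
    by (simp add: inner_ell2_def nth inner_add_left suminf_add summable_inner_ell2)
  show "inner (t *\<^sub>R x) y = t * inner x y"
    by (simp add: inner_ell2_def nth suminf_mult summable_inner_ell2)
  show "0 \<le> inner x x" unfolding inner_ell2_def by (intro suminf_nonneg summable_inner_ell2) simp
  show "inner x x = 0 \<longleftrightarrow> x = 0"
    by (simp add: inner_ell2_def suminf_eq_zero_iff summable_inner_ell2
        ell2_nth_inject[symmetric] nth fun_eq_iff)
  show "cinner (x + y) z = cinner x z + cinner y z"
    by (simp add: cinner_ell2_def nth cinner_add_left suminf_add summable_cinner_ell2)
  show "cinner (a *\<^sub>C x) y = a * cinner x y"
    by (simp add: cinner_ell2_def nth cinner_scaleC_left suminf_mult summable_cinner_ell2)
  have "cnj (cinner y x) = (\<Sum>n. cnj (cinner (ell2_nth y n) (ell2_nth x n)))"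
    unfolding cinner_ell2_def
    by (intro sums_unique) (simp only: sums_cnj summable_sums summable_cinner_ell2)
  then show "cinner x y = cnj (cinner y x)"
    by (simp add: cinner_ell2_def cinner_commute[symmetric])
  show "inner x y = Re (cinner x y)"
    by (simp add: inner_ell2_def cinner_ell2_def inner_Re_cinner Re_suminf summable_cinner_ell2)
qed

end

lemma norm_ell2_sq: "(norm (x :: 'a :: complex_inner ell2))\<^sup>2 = (\<Sum>n. (norm (ell2_nth x n))\<^sup>2)"
  by (simp add: power2_norm_eq_inner inner_ell2_def)

lemma norm_ell2_nth_le: "norm (ell2_nth x n) \<le> norm (x :: 'a :: complex_inner ell2)"
proof -
  have "(\<Sum>k\<in>{n}. (norm (ell2_nth x k))\<^sup>2) \<le> (norm x)\<^sup>2"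
    unfolding norm_ell2_sq by (rule sum_le_suminf[OF ell2_summable]) auto
  then have "(norm (ell2_nth x n))\<^sup>2 \<le> (norm x)\<^sup>2" by simp
  then show ?thesis by (rule power2_le_imp_le) simp
qed

lemma sum_norm_ell2_le: "(\<Sum>k<m. (norm (ell2_nth x k))\<^sup>2) \<le> (norm (x :: 'a :: complex_inner ell2))\<^sup>2"
  unfolding norm_ell2_sq by (rule sum_le_suminf[OF ell2_summable]) auto

instance ell2 :: (complex_hilbert) complex_hilbert
proof
  fix X :: "nat \<Rightarrow> 'a ell2"
  assume X: "Cauchy X"
  have "Cauchy (\<lambda>i. ell2_nth (X i) n)" for n
  proof (rule metric_CauchyI)
    fix e :: real assume "0 < e"
    then obtain N where N: "\<And>i j. i \<ge> N \<Longrightarrow> j \<ge> N \<Longrightarrow> norm (X i - X j) < e"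
      using CauchyD[OF X] by blast
    have "dist (ell2_nth (X i) n) (ell2_nth (X j) n) < e" if "i \<ge> N" "j \<ge> N" for i j
      using norm_ell2_nth_le[of "X i - X j" n] N[OF that]
      by (simp add: dist_norm minus_ell2.rep_eq)
    then show "\<exists>N. \<forall>i\<ge>N. \<forall>j\<ge>N. dist (ell2_nth (X i) n) (ell2_nth (X j) n) < e" by blast
  qed
  then have "\<exists>L. (\<lambda>i. ell2_nth (X i) n) \<longlonglongrightarrow> L" for n
    using Cauchy_convergent[of "\<lambda>i. ell2_nth (X i) n"] unfolding convergent_def by simp
  then obtain l where l: "\<And>n. (\<lambda>i. ell2_nth (X i) n) \<longlonglongrightarrow> l n" by metis
  have tail: "\<exists>N. \<forall>i\<ge>N. \<forall>m. (\<Sum>k<m. (norm (ell2_nth (X i) k - l k))\<^sup>2) \<le> e\<^sup>2" if e: "0 < e" for e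
  proof -
    obtain N where N: "\<And>i j. i \<ge> N \<Longrightarrow> j \<ge> N \<Longrightarrow> norm (X i - X j) < e"
      using CauchyD[OF X e] by blast
    have "(\<Sum>k<m. (norm (ell2_nth (X i) k - l k))\<^sup>2) \<le> e\<^sup>2" if i: "i \<ge> N" for i m
    proof (rule LIMSEQ_le_const2)
      show "(\<lambda>j. \<Sum>k<m. (norm (ell2_nth (X i) k - ell2_nth (X j) k))\<^sup>2)
          \<longlonglongrightarrow> (\<Sum>k<m. (norm (ell2_nth (X i) k - l k))\<^sup>2)"
        by (intro tendsto_sum tendsto_power tendsto_norm tendsto_diff tendsto_const l)
      have "(\<Sum>k<m. (norm (ell2_nth (X i) k - ell2_nth (X j) k))\<^sup>2) \<le> e\<^sup>2" if "j \<ge> N" for j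
      proof -
        have "(\<Sum>k<m. (norm (ell2_nth (X i) k - ell2_nth (X j) k))\<^sup>2) \<le> (norm (X i - X j))\<^sup>2"
          using sum_norm_ell2_le[where x = "X i - X j"] by (simp add: minus_ell2.rep_eq)
        also have "\<dots> \<le> e\<^sup>2" using N[OF i that] by (simp add: power_mono)
        finally show ?thesis .
      qed
      then show "\<exists>N. \<forall>j\<ge>N. (\<Sum>k<m. (norm (ell2_nth (X i) k - ell2_nth (X j) k))\<^sup>2) \<le> e\<^sup>2"
        by blast
    qed
    then show ?thesis by blast
  qed
  have diff_summable: "summable (\<lambda>k. (norm (ell2_nth (X i) k - l k))\<^sup>2)"
    if "\<And>m. (\<Sum>k<m. (norm (ell2_nth (X i) k - l k))\<^sup>2) \<le> e\<^sup>2" for i e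
    by (rule summableI_nonneg_bounded[where x = "e\<^sup>2"]) (simp, rule that)
  obtain N where N: "\<forall>i\<ge>N. \<forall>m. (\<Sum>k<m. (norm (ell2_nth (X i) k - l k))\<^sup>2) \<le> 1\<^sup>2"
    using tail[OF zero_less_one] by (rule exE)
  have "summable (\<lambda>k. (norm (ell2_nth (X N) k - l k))\<^sup>2)"
    by (rule diff_summable[of N 1]) (use N in simp)
  then have "summable (\<lambda>k. (norm (l k - ell2_nth (X N) k))\<^sup>2)" by (simp add: norm_minus_commute)
  from square_summable_add[OF this ell2_summable[of "X N"]]
  have "summable (\<lambda>k. (norm (l k))\<^sup>2)" by simp
  then have L: "ell2_nth (Abs_ell2 l) = l" by (intro Abs_ell2_inverse CollectI)
  have "X \<longlonglongrightarrow> Abs_ell2 l"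
  proof (rule metric_LIMSEQ_I)
    fix e :: real assume e: "0 < e"
    obtain N where N: "\<forall>i\<ge>N. \<forall>m. (\<Sum>k<m. (norm (ell2_nth (X i) k - l k))\<^sup>2) \<le> (e/2)\<^sup>2"
      using tail[OF half_gt_zero[OF e]] by (rule exE)
    have "dist (X i) (Abs_ell2 l) < e" if "i \<ge> N" for i
    proof -
      have "(norm (X i - Abs_ell2 l))\<^sup>2 \<le> (e/2)\<^sup>2"
        unfolding norm_ell2_sq
        by (rule suminf_le_const[OF ell2_summable]) (simp add: minus_ell2.rep_eq L N[rule_format, OF that] del: power_divide)
      then have "norm (X i - Abs_ell2 l) \<le> e / 2" by (rule power2_le_imp_le) (use e in simp)
      then show ?thesis using e by (simp add: dist_norm)
    qed
    then show "\<exists>N. \<forall>i\<ge>N. dist (X i) (Abs_ell2 l) < e" by blast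
  qed
  then show "convergent X" by (rule convergentI)
qed

end

theory Submission
  imports Defs
begin

text \<open>
  The compressions of \<open>U diag (r I, I)\<close> and its inverse inherit the norm bounds. Conversely,
  membership in the class means \<open>r\<^sup>2 \<le> S \<le> 1\<close> for \<open>S = T* T\<close>. Let \<open>X\<close> be a self-adjoint
  square root of \<open>(1 - S) (S - r\<^sup>2)\<close> commuting with \<open>S\<close>, and \<open>L\<close> the adjoint of the inverse
  of \<open>T\<close>. The block matrix \<open>J = [[T, L X], [0, r L]]\<close> is invertible, and \<open>J\<^sup>n\<close> extends \<open>T\<^sup>n\<close>
  for every integer \<open>n\<close>. Its modulus is \<open>D = [[S + r, X], [X, 1 + r + r\<^sup>2 - S]] / (1 + r)\<close>,
  which satisfies \<open>(D - 1) (D - r) = 0\<close>; hence \<open>J D\<^sup>-\<^sup>1\<close> is unitary and \<open>D\<close> is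
  \<open>diag (r I, I)\<close> in terms of its eigenspaces. On the remaining coordinates of the sequence space
  \<open>J\<close> and \<open>D\<close> are the identity.
\<close>

section \<open>Inner products and bounded operators\<close>

instance complex_hilbert \<subseteq> banach ..

lemma cinner_add_right: "cinner x (y + z) = cinner x y + cinner x z"
  by (metis cinner_add_left cinner_commute complex_cnj_add)

lemma cinner_scaleC_right: "cinner x (a *\<^sub>C y) = cnj a * cinner x y"
  by (metis cinner_scaleC_left cinner_commute complex_cnj_mult)

lemma cinner_scaleR_left: "cinner (t *\<^sub>R x) y = of_real t * cinner x y"
  by (simp add: scaleR_scaleC cinner_scaleC_left)

lemma cinner_scaleR_right: "cinner x (t *\<^sub>R y) = of_real t * cinner x y"
  by (simp add: scaleR_scaleC cinner_scaleC_right)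

lemma cinner_minus_left: "cinner (- x) y = - cinner x y"
  using cinner_scaleR_left[of "-1" x y] by simp

lemma cinner_minus_right: "cinner x (- y) = - cinner x y"
  using cinner_scaleR_right[of x "-1" y] by simp

lemma cinner_diff_left: "cinner (x - y) z = cinner x z - cinner y z"
  using cinner_add_left[of x "- y" z] by (simp add: cinner_minus_left)

lemma cinner_diff_right: "cinner x (y - z) = cinner x y - cinner x z"
  using cinner_add_right[of x y "- z"] by (simp add: cinner_minus_right)

lemma cinner_zero_left [simp]: "cinner 0 x = 0"
  using cinner_diff_left[of 0 0 x] by simp

lemma cinner_zero_right [simp]: "cinner x 0 = 0"
  using cinner_diff_right[of x 0 0] by simp

lemmas cinner_simps =
  cinner_add_left cinner_add_right cinner_diff_left cinner_diff_right
  cinner_scaleR_left cinner_scaleR_right cinner_minus_left cinner_minus_right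

lemma cinner_ext:
  assumes "\<And>z. cinner x z = cinner y z"
  shows "x = y"
proof -
  have "inner (x - y) (x - y) = 0"
    using assms[of "x - y"] by (simp add: inner_Re_cinner cinner_diff_left)
  then show ?thesis by simp
qed

lemma scaleC_scaleR_commute: "a *\<^sub>C t *\<^sub>R x = t *\<^sub>R a *\<^sub>C x"
  by (simp add: scaleR_scaleC scaleC_scaleC mult.commute)

lemma scaleC_minus_right: "a *\<^sub>C (- x) = - (a *\<^sub>C x)"
  using scaleC_scaleR_commute[of a "-1" x] by simp

lemma scaleC_diff_right: "a *\<^sub>C (x - y) = a *\<^sub>C x - a *\<^sub>C y"
  using scaleC_add_right[of a x "- y"] by (simp add: scaleC_minus_right)

lemma scaleC_zero_right [simp]: "a *\<^sub>C 0 = 0"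
  using scaleC_diff_right[of a 0 0] by simp

section \<open>Calculus of bounded complex-linear maps\<close>

lemma bounded_clinearI:
  assumes "\<And>x y. A (x + y) = A x + A y" "\<And>a x. A (a *\<^sub>C x) = a *\<^sub>C A x"
    and "\<And>x. norm (A x) \<le> norm x * K"
  shows "bounded_clinear A"
  unfolding bounded_clinear_def
  by (intro conjI bounded_linear_intro[where K = K]) (simp_all add: assms scaleR_scaleC)

lemma bounded_clinear_imp_bounded_linear: "bounded_clinear A \<Longrightarrow> bounded_linear A"
  by (simp add: bounded_clinear_def)

lemma bounded_clinear_scaleC: "bounded_clinear A \<Longrightarrow> A (a *\<^sub>C x) = a *\<^sub>C A x"
  by (simp add: bounded_clinear_def)

lemma bounded_clinear_simps:
  assumes "bounded_clinear A"
  shows "A (x + y) = A x + A y" "A (x - y) = A x - A y" "A (- x) = - A x"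
    "A (t *\<^sub>R x) = t *\<^sub>R A x" "A 0 = 0"
  using bounded_clinear_imp_bounded_linear[OF assms, THEN bounded_linear.linear]
  by (simp_all add: linear_add linear_diff linear_neg linear_scale linear_0)

lemma bounded_clinear_zero: "bounded_clinear (\<lambda>_. 0)"
  by (simp add: bounded_clinear_def)

lemma bounded_clinear_id: "bounded_clinear (\<lambda>x. x)"
  by (simp add: bounded_clinear_def bounded_linear_ident)

lemma bounded_clinear_add:
  "bounded_clinear A \<Longrightarrow> bounded_clinear B \<Longrightarrow> bounded_clinear (\<lambda>x. A x + B x)"
  by (simp add: bounded_clinear_def bounded_linear_add scaleC_add_right)

lemma bounded_clinear_diff:
  "bounded_clinear A \<Longrightarrow> bounded_clinear B \<Longrightarrow> bounded_clinear (\<lambda>x. A x - B x)"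
  by (simp add: bounded_clinear_def bounded_linear_sub scaleC_diff_right)

lemma bounded_clinear_uminus: "bounded_clinear A \<Longrightarrow> bounded_clinear (\<lambda>x. - A x)"
  by (simp add: bounded_clinear_def bounded_linear_minus scaleC_minus_right)

lemma bounded_clinear_scaleR: "bounded_clinear A \<Longrightarrow> bounded_clinear (\<lambda>x. t *\<^sub>R A x)"
  by (auto simp: bounded_clinear_def scaleC_scaleR_commute intro: bounded_linear_const_scaleR)

lemma bounded_clinear_compose:
  "bounded_clinear A \<Longrightarrow> bounded_clinear B \<Longrightarrow> bounded_clinear (\<lambda>x. A (B x))"
  by (simp add: bounded_clinear_def bounded_linear_compose)

lemmas bounded_clinear_intros =
  bounded_clinear_zero bounded_clinear_id bounded_clinear_add bounded_clinear_diff
  bounded_clinear_uminus bounded_clinear_scaleR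

section \<open>Contractions, inverses, and the class in terms of pointwise norm inequalities\<close>

lemma onorm_le_1_iff:
  assumes "bounded_linear A"
  shows "onorm A \<le> 1 \<longleftrightarrow> (\<forall>x. norm (A x) \<le> norm x)"
proof
  assume le: "onorm A \<le> 1"
  show "\<forall>x. norm (A x) \<le> norm x"
  proof
    fix x
    show "norm (A x) \<le> norm x"
      using onorm[OF assms, of x] mult_right_mono[OF le norm_ge_zero[of x]] by simp
  qed
qed (simp add: onorm_bound)

lemma invertible_op_bij: "invertible_op A \<Longrightarrow> bij A"
  unfolding invertible_op_def using o_bij by blast

lemma invertible_op_inv: "invertible_op A \<Longrightarrow> bounded_clinear (inv A)"
  unfolding invertible_op_def using inv_unique_comp by metis

lemma class_C1_iff:
  assumes "0 < r" "invertible_op T"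
  shows "T \<in> class_C1 r \<longleftrightarrow> (\<forall>x. norm (T x) \<le> norm x) \<and> (\<forall>x. r * norm (inv T x) \<le> norm x)"
proof -
  have "bounded_linear T" "bounded_linear (\<lambda>x. r *\<^sub>R inv T x)"
    using assms invertible_op_inv[OF assms(2)]
    by (auto simp: invertible_op_def intro: bounded_clinear_imp_bounded_linear bounded_clinear_scaleR)
  from this[THEN onorm_le_1_iff] show ?thesis
    using assms by (simp add: class_C1_def)
qed

lemma isometric_embedding_norm: "isometric_embedding V \<Longrightarrow> norm (V x) = norm x"
  by (simp add: isometric_embedding_def norm_eq_sqrt_inner inner_Re_cinner)

text \<open>An isometric image of a complete space is complete, hence closed. This makes
  \<open>orth_proj (range V)\<close> a genuine projection.\<close>

lemma isometric_embedding_range: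
  fixes V :: "'a :: complex_hilbert \<Rightarrow> 'b :: complex_inner"
  assumes V: "isometric_embedding V"
  shows "csubspace (range V)" "closed (range V)"
proof -
  have lin: "bounded_clinear V" using V by (simp add: isometric_embedding_def)
  note simps = bounded_clinear_simps[OF lin, symmetric] bounded_clinear_scaleC[OF lin, symmetric]
  show "csubspace (range V)"
    unfolding csubspace_def
  proof (intro conjI ballI allI)
    show "0 \<in> range V" using simps(5) by (metis rangeI)
  qed (auto simp: simps(1,6))
  have "complete (range V)"
    by (rule complete_isometric_image[where e = 1])
      (auto simp: isometric_embedding_norm[OF V] bounded_clinear_imp_bounded_linear[OF lin]
        complete_UNIV)
  then show "closed (range V)" by (rule complete_imp_closed)
qed

lemma norm_add_orthogonal:
  assumes "cinner x y = 0"
  shows "(norm (x + y))\<^sup>2 = (norm x)\<^sup>2 + (norm y)\<^sup>2"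
proof -
  have "inner x y = 0" using assms by (simp add: inner_Re_cinner)
  then show ?thesis
    unfolding power2_norm_eq_inner by (simp add: inner_add_left inner_add_right inner_commute)
qed

lemma norm_orth_proj_le:
  fixes M :: "'a :: complex_hilbert set"
  assumes "csubspace M" "closed M"
  shows "norm (orth_proj M x) \<le> norm x"
proof -
  have "cinner (x - orth_proj M x) (orth_proj M x) = 0"
    using orth_proj[OF assms] by blast
  from norm_add_orthogonal[OF this] have "(norm (orth_proj M x))\<^sup>2 \<le> (norm x)\<^sup>2" by simp
  then show ?thesis by (rule power2_le_imp_le) simp
qed


section \<open>Dilations of the block form give members of the class\<close>

lemma orth_decomp_proj:
  assumes "orth_decomp K0 K1" "x \<in> K0" "y \<in> K1"
  shows "orth_proj K0 (x + y) = x" "orth_proj K1 (x + y) = y"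
proof -
  have orth: "cinner a b = 0 \<and> cinner b a = 0" if "a \<in> K0" "b \<in> K1" for a b
    using assms(1) that cinner_commute[of b a] by (simp add: orth_decomp_def)
  show "orth_proj K0 (x + y) = x" "orth_proj K1 (x + y) = y"
    using assms orth by (auto intro!: orth_proj_unique simp: orth_decomp_def)
qed

text \<open>\<open>U\<close> preserves norms, and the diagonal part scales two orthogonal components
  by \<open>r\<close> and 1, so Pythagoras bounds the scaling of the whole vector by these
  extremes.\<close>

lemma unitary_diag_form_norm:
  assumes r: "0 < r" "r < 1" and J: "unitary_diag_form r J"
  shows "norm (J z) \<le> norm z" "r * norm z \<le> norm (J z)"
proof -
  obtain U K0 K1 where U: "unitary_op U" and K: "orth_decomp K0 K1"
    and J_eq: "J = U \<circ> diag_op K0 K1 r 1"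
    using J by (auto simp: unitary_diag_form_def)
  obtain x y where xy: "x \<in> K0" "y \<in> K1" "z = x + y" using K unfolding orth_decomp_def by blast
  have o: "cinner x y = 0" using K xy by (simp add: orth_decomp_def)
  have "norm (J z) = norm (r *\<^sub>R x + y)"
    using U orth_decomp_proj[OF K xy(1,2)]
    by (simp add: J_eq diag_op_def xy(3) isometric_embedding_norm unitary_op_def)
  then have Jz: "(norm (J z))\<^sup>2 = r\<^sup>2 * (norm x)\<^sup>2 + (norm y)\<^sup>2"
    using norm_add_orthogonal[of "r *\<^sub>R x" y] o
    by (simp add: cinner_scaleR_left power_mult_distrib)
  have z: "(norm z)\<^sup>2 = (norm x)\<^sup>2 + (norm y)\<^sup>2" using norm_add_orthogonal[OF o] xy by simp
  have r2: "r\<^sup>2 \<le> 1" using r by (simp add: power_le_one)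
  have "r\<^sup>2 * (norm x)\<^sup>2 \<le> 1 * (norm x)\<^sup>2" "r\<^sup>2 * (norm y)\<^sup>2 \<le> 1 * (norm y)\<^sup>2"
    using r2 by (intro mult_right_mono; simp)+
  then have "(norm (J z))\<^sup>2 \<le> (norm z)\<^sup>2" "(r * norm z)\<^sup>2 \<le> (norm (J z))\<^sup>2"
    unfolding Jz power_mult_distrib z by (simp_all add: algebra_simps)
  then show "norm (J z) \<le> norm z" "r * norm z \<le> norm (J z)"
    by (auto intro: power2_le_imp_le)
qed

text \<open>A compression does not increase norms; the exponents 1 and -1 give the two defining
  inequalities of the class.\<close>

lemma dilation_imp_class_C1:
  fixes V :: "'a :: complex_hilbert \<Rightarrow> 'b :: complex_hilbert"
  assumes r: "0 < r" "r < 1" and T: "invertible_op T"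
    and dil: "power_dilation V J T" and J: "unitary_diag_form r J"
  shows "T \<in> class_C1 r"
proof -
  have V: "isometric_embedding V" and Jinv: "invertible_op J"
    and pow: "V (op_powi T n x) = orth_proj (range V) (op_powi J n (V x))" for n x
    using dil by (auto simp: power_dilation_def)
  have le: "norm (op_powi T n x) \<le> norm (op_powi J n (V x))" for n x
    using norm_orth_proj_le[OF isometric_embedding_range[OF V], of "op_powi J n (V x)"]
    by (simp add: pow[symmetric] isometric_embedding_norm[OF V])
  have "norm (T x) \<le> norm x" for x
    using le[of 1 x] unitary_diag_form_norm(1)[OF r J, of "V x"]
    by (simp add: op_powi_def isometric_embedding_norm[OF V])
  moreover have "r * norm (inv T x) \<le> norm x" for x
  proof -
    have "norm (inv T x) \<le> norm (inv J (V x))"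
      using le[of "-1" x] by (simp add: op_powi_def)
    then have "r * norm (inv T x) \<le> r * norm (inv J (V x))" using r by simp
    \<comment> \<open>The lower bound on \<open>J\<close>, taken at \<open>inv J (V x)\<close>, is
      the upper bound on its inverse.\<close>
    also have "\<dots> \<le> norm (J (inv J (V x)))" by (rule unitary_diag_form_norm(2)[OF r J])
    also have "\<dots> = norm x"
      using invertible_op_bij[OF Jinv]
      by (simp add: bij_is_surj surj_f_inv_f isometric_embedding_norm[OF V])
    finally show ?thesis .
  qed
  ultimately show ?thesis by (simp add: class_C1_iff[OF r(1) T])
qed


section \<open>Adjoints\<close>

text \<open>A vector \<open>z\<close> orthogonal to the kernel with \<open>f z\<close> nonzero
  determines \<open>f\<close>, because \<open>x - (f x / f z) *\<^sub>C z\<close> always lies in the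
  kernel.\<close>

lemma riesz:
  fixes f :: "'a :: complex_hilbert \<Rightarrow> complex"
  assumes f: "bounded_clinear f"
  shows "\<exists>y. \<forall>x. f x = cinner x y"
proof (cases "\<forall>x. f x = 0")
  case False
  then obtain x0 where x0: "f x0 \<noteq> 0" by blast
  define M where "M = {x. f x = 0}"
  note simps = bounded_clinear_simps[OF f] bounded_clinear_scaleC[OF f] scaleC_complex_def
  have M: "csubspace M" by (simp add: csubspace_def M_def simps)
  have "continuous_on UNIV f"
    by (rule linear_continuous_on[OF bounded_clinear_imp_bounded_linear[OF f]])
  then have cl: "closed M" unfolding M_def by (intro closed_Collect_eq) auto
  define z where "z = x0 - orth_proj M x0"
  have zM: "cinner z w = 0" if "w \<in> M" for w
    unfolding z_def by (rule orth_proj_orthogonal[OF M cl that])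
  have fz: "f z \<noteq> 0" using orth_proj_in[OF M cl, of x0] x0 by (simp add: z_def simps M_def)
  then have z0: "cinner z z \<noteq> 0" using simps(5) by (auto simp: cinner_self)
  \<comment> \<open>The form is conjugate-linear in its second argument, whence the conjugate in the
    scalar; \<open>cinner z z\<close> is real.\<close>
  have "f x = cinner x ((cnj (f z) / cinner z z) *\<^sub>C z)" for x
  proof -
    have "x - (f x / f z) *\<^sub>C z \<in> M" using fz by (simp add: M_def simps)
    from zM[OF this] have "cnj (cinner z (x - (f x / f z) *\<^sub>C z)) = 0" by simp
    then have "cinner (x - (f x / f z) *\<^sub>C z) z = 0" using cinner_commute by metis
    then have "cinner x z = f x / f z * cinner z z"
      by (simp add: cinner_diff_left cinner_scaleC_left)
    moreover have "cnj (cinner z z) = cinner z z" using cinner_commute[of z z] by simp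
    ultimately show ?thesis using fz z0 by (simp add: cinner_scaleC_right)
  qed
  then show ?thesis by blast
qed (auto intro: exI[of _ 0])

text \<open>A relation instead of an operation, so that self-adjointness is simply
  \<open>adjoint_pair A A\<close>.\<close>

definition adjoint_pair :: "('a :: complex_inner \<Rightarrow> 'a) \<Rightarrow> ('a \<Rightarrow> 'a) \<Rightarrow> bool" where
  "adjoint_pair A B \<longleftrightarrow> (\<forall>x y. cinner (A x) y = cinner x (B y))"

lemma adjoint_pairD: "adjoint_pair A B \<Longrightarrow> cinner (A x) y = cinner x (B y)"
  by (simp add: adjoint_pair_def)

lemma adjoint_pairD': "adjoint_pair A B \<Longrightarrow> cinner (B x) y = cinner x (A y)"
  unfolding adjoint_pair_def by (metis cinner_commute)

lemma adjoint_exists: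
  fixes A :: "'a :: complex_hilbert \<Rightarrow> 'a"
  assumes A: "bounded_clinear A"
  obtains B where "bounded_clinear B" "adjoint_pair A B"
proof -
  obtain K where K: "\<And>x. norm (A x) \<le> norm x * K"
    using bounded_linear.bounded[OF bounded_clinear_imp_bounded_linear[OF A]] by blast
  have "bounded_clinear (\<lambda>x. cinner (A x) y)" for y
  proof (rule bounded_clinearI)
    fix x
    have "norm (cinner (A x) y) \<le> norm (A x) * norm y" by (rule cinner_norm_le)
    also have "\<dots> \<le> norm x * K * norm y" by (intro mult_right_mono K) simp
    finally show "norm (cinner (A x) y) \<le> norm x * (K * norm y)" by (simp add: mult.assoc)
  qed (simp_all add: bounded_clinear_simps[OF A] bounded_clinear_scaleC[OF A] cinner_add_left
      cinner_scaleC_left scaleC_complex_def)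
  from riesz[OF this] have "\<forall>y. \<exists>b. \<forall>x. cinner (A x) y = cinner x b" by blast
  from choice[OF this] obtain B where B: "adjoint_pair A B" by (auto simp: adjoint_pair_def)
  have "bounded_clinear B"
  proof (rule bounded_clinearI)
    fix x
    \<comment> \<open>\<open>B\<close> inherits the bound \<open>K\<close> of \<open>A\<close>: the
      square of \<open>norm (B x)\<close> is \<open>cinner x (A (B x))\<close>, and one factor
      \<open>norm (B x)\<close> cancels.\<close>
    have "norm (B x) * norm (B x) = cmod (cinner (B x) (B x))"
      by (simp add: cinner_self power2_eq_square norm_mult)
    also have "\<dots> = cmod (cinner x (A (B x)))" by (simp add: adjoint_pairD'[OF B])
    also have "\<dots> \<le> norm x * norm (A (B x))" by (rule cinner_norm_le)
    also have "\<dots> \<le> norm x * (norm (B x) * K)" by (intro mult_left_mono K) simp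
    finally have *: "norm (B x) * norm (B x) \<le> (norm x * K) * norm (B x)" by (simp add: mult_ac)
    show "norm (B x) \<le> norm x * K"
    proof (cases "B x = 0")
      case True
      have "0 \<le> norm x * K" using order_trans[OF norm_ge_zero K] .
      then show ?thesis using True by simp
    next
      case False
      then show ?thesis using * by (simp add: mult_le_cancel_right)
    qed
  qed (rule cinner_ext; simp add: adjoint_pairD'[OF B] cinner_add_left cinner_scaleC_left)+
  then show thesis using B that by blast
qed


section \<open>Self-adjoint operators and square roots\<close>

text \<open>Polarization writes \<open>inner (A x) y\<close> through two values of the quadratic
  form, and the parallelogram law adds up their bounds. This turns two-sided form bounds into a norm
  bound.\<close>

lemma selfadjoint_norm_le:
  assumes A: "bounded_clinear A" "adjoint_pair A A"
    and le: "\<And>x. \<bar>inner (A x) x\<bar> \<le> c * (norm x)\<^sup>2"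
  shows "norm (A x) \<le> c * norm x"
proof (cases "x = 0 \<or> A x = 0")
  case True
  have "0 \<le> c * norm x"
  proof (cases "x = 0")
    case False
    have "0 \<le> c * (norm x)\<^sup>2" using le[of x] by linarith
    then show ?thesis using False by (simp add: zero_le_mult_iff)
  qed simp
  then show ?thesis using True bounded_clinear_simps(5)[OF A(1)] by auto
next
  case False
  \<comment> \<open>The factor \<open>t\<close> makes both arguments of the polarization identity equally long.\<close>
  define t where "t = norm x / norm (A x)"
  define y where "y = t *\<^sub>R A x"
  have t: "0 < t" using False by (simp add: t_def)
  have ny: "norm y = norm x" using False t by (simp add: y_def t_def)
  have sym: "inner (A y) x = inner (A x) y"
    using adjoint_pairD[OF A(2), of y x] by (metis inner_Re_cinner inner_commute)
  have "4 * inner (A x) y = inner (A (x + y)) (x + y) - inner (A (x - y)) (x - y)"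
    by (simp add: bounded_clinear_simps[OF A(1)] inner_add_left inner_add_right
        inner_diff_left inner_diff_right sym)
  also have "\<dots> \<le> c * (norm (x + y))\<^sup>2 + c * (norm (x - y))\<^sup>2"
    using le[of "x + y"] le[of "x - y"] by linarith
  also have "\<dots> = 4 * (c * (norm x)\<^sup>2)"
  proof -
    have "(norm (x + y))\<^sup>2 + (norm (x - y))\<^sup>2 = 2 * (norm x)\<^sup>2 + 2 * (norm y)\<^sup>2"
      unfolding power2_norm_eq_inner by (simp add: algebra_simps)
    then show ?thesis by (simp add: ny distrib_left[symmetric])
  qed
  finally have "inner (A x) y \<le> c * (norm x)\<^sup>2" by simp
  moreover have "inner (A x) y = norm x * norm (A x)"
    using False by (simp add: y_def t_def power2_norm_eq_inner[symmetric] power2_eq_square)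
  ultimately have "norm x * norm (A x) \<le> norm x * (c * norm x)"
    by (simp add: power2_eq_square mult_ac)
  then show ?thesis using False by (simp add: mult_le_cancel_left)
qed

text \<open>
  The iteration \<open>Y \<mapsto> (A + Y\<^sup>2) / 2\<close> tends to \<open>1 - sqrt (1 - A)\<close>. Its steps factor as products of
  commuting operators, so they are dominated by those of the scalar iteration for \<open>A = 1\<close>, which
  is monotone and bounded; this gives convergence without assuming \<open>\<parallel>A\<parallel> < 1\<close>.
\<close>

primrec sqrt_iter_real :: "nat \<Rightarrow> real" where
  "sqrt_iter_real 0 = 0"
| "sqrt_iter_real (Suc n) = (1 + (sqrt_iter_real n)\<^sup>2) / 2"

lemma sqrt_iter_real_bounds: "0 \<le> sqrt_iter_real n \<and> sqrt_iter_real n \<le> 1"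
  by (induction n) (auto simp: power_le_one)

lemma sqrt_iter_real_mono: "sqrt_iter_real n \<le> sqrt_iter_real (Suc n)"
  using zero_le_power2[of "sqrt_iter_real n - 1"] by (simp add: power2_eq_square algebra_simps)

primrec sqrt_iter :: "('a :: real_vector \<Rightarrow> 'a) \<Rightarrow> nat \<Rightarrow> 'a \<Rightarrow> 'a" where
  "sqrt_iter A 0 = (\<lambda>_. 0)"
| "sqrt_iter A (Suc n) = (\<lambda>x. (1/2) *\<^sub>R (A x + sqrt_iter A n (sqrt_iter A n x)))"

lemma sqrt_iter_bounded_clinear: "bounded_clinear A \<Longrightarrow> bounded_clinear (sqrt_iter A n)"
proof (induction n)
  case (Suc n)
  note bounded_clinear_compose[OF Suc.IH Suc.IH, OF Suc.prems Suc.prems]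
  then show ?case using Suc.prems by (auto intro!: bounded_clinear_intros)
qed (simp add: bounded_clinear_zero)

lemma sqrt_iter_selfadjoint: "adjoint_pair A A \<Longrightarrow> adjoint_pair (sqrt_iter A n) (sqrt_iter A n)"
  by (induction n) (auto simp: adjoint_pair_def cinner_simps)

text \<open>Every iterate is a polynomial in \<open>A\<close>.\<close>

lemma sqrt_iter_commute:
  assumes B: "bounded_clinear B" and AB: "\<And>x. A (B x) = B (A x)"
  shows "sqrt_iter A n (B x) = B (sqrt_iter A n x)"
  by (induction n arbitrary: x) (simp_all add: bounded_clinear_simps[OF B] AB)

text \<open>The operator recursion is majorized term by term by the scalar one, in which
  \<open>A\<close> is replaced by 1.\<close>

lemma sqrt_iter_norm_le:
  assumes "\<And>x. norm (A x) \<le> norm x"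
  shows "norm (sqrt_iter A n x) \<le> sqrt_iter_real n * norm x"
proof (induction n arbitrary: x)
  case (Suc n)
  let ?y = "sqrt_iter_real n"
  have "norm (sqrt_iter A n (sqrt_iter A n x)) \<le> ?y * norm (sqrt_iter A n x)" by (rule Suc)
  also have "\<dots> \<le> ?y * (?y * norm x)"
    using sqrt_iter_real_bounds by (intro mult_left_mono Suc) auto
  finally have "norm (A x + sqrt_iter A n (sqrt_iter A n x)) \<le> norm x + ?y * (?y * norm x)"
    using norm_triangle_ineq assms by (metis add_mono order_trans)
  then show ?case by (simp add: power2_eq_square algebra_simps flip: scaleR_add_right)
qed simp

lemma sqrt_iter_step_le:
  assumes A: "bounded_clinear A" and le: "\<And>x. norm (A x) \<le> norm x"
  shows "norm (sqrt_iter A (Suc n) x - sqrt_iter A n x)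
    \<le> (sqrt_iter_real (Suc n) - sqrt_iter_real n) * norm x"
proof (induction n arbitrary: x)
  case 0
  then show ?case using le[of x] by simp
next
  case (Suc n)
  let ?Y = "sqrt_iter A" and ?y = "sqrt_iter_real"
  \<comment> \<open>The sum factor in the difference of squares of consecutive iterates;
    \<open>comm\<close> makes the factorization valid.\<close>
  define Z where "Z x = ?Y (Suc n) x + ?Y n x" for x
  have comm: "?Y m (?Y k x) = ?Y k (?Y m x)" for m k x
  proof (rule sqrt_iter_commute[OF sqrt_iter_bounded_clinear[OF A]])
    show "A (?Y k x) = ?Y k (A x)" for x by (rule sqrt_iter_commute[OF A, symmetric]) simp
  qed
  note simps = bounded_clinear_simps[OF sqrt_iter_bounded_clinear[OF A]]
  have "?Y (Suc (Suc n)) x - ?Y (Suc n) x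
      = (1/2) *\<^sub>R (?Y (Suc n) (?Y (Suc n) x) - ?Y n (?Y n x))"
    unfolding sqrt_iter.simps(2)[of A "Suc n"] sqrt_iter.simps(2)[of A n]
    by (simp add: algebra_simps)
  also have "\<dots> = (1/2) *\<^sub>R (?Y (Suc n) (Z x) - ?Y n (Z x))"
    unfolding Z_def simps(1) by (simp only: comm[of "Suc n" n]) simp
  finally have "norm (?Y (Suc (Suc n)) x - ?Y (Suc n) x)
      = (1/2) * norm (?Y (Suc n) (Z x) - ?Y n (Z x))" by simp
  also have "\<dots> \<le> (1/2) * ((?y (Suc n) - ?y n) * norm (Z x))"
    using Suc by (intro mult_left_mono) auto
  also have "\<dots> \<le> (1/2) * ((?y (Suc n) - ?y n) * ((?y (Suc n) + ?y n) * norm x))"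
  proof (intro mult_left_mono)
    show "norm (Z x) \<le> (?y (Suc n) + ?y n) * norm x"
      unfolding Z_def distrib_right
      by (rule order_trans[OF norm_triangle_ineq add_mono[OF sqrt_iter_norm_le[OF le] sqrt_iter_norm_le[OF le]]])
  qed (use sqrt_iter_real_mono[of n] in auto)
  also have "\<dots> = (?y (Suc (Suc n)) - ?y (Suc n)) * norm x"
    unfolding sqrt_iter_real.simps(2)[of "Suc n"] sqrt_iter_real.simps(2)[of n]
    by (simp add: power2_eq_square field_simps)
  finally show ?case .
qed

lemma sqrt_one_minus_exists:
  fixes A :: "'a :: complex_hilbert \<Rightarrow> 'a"
  assumes A: "bounded_clinear A" "adjoint_pair A A" and le: "\<And>x. norm (A x) \<le> norm x"
  shows "\<exists>X. bounded_clinear X \<and> adjoint_pair X X \<and> (\<forall>x. X (X x) = x - A x) \<and>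
    (\<forall>B. bounded_clinear B \<longrightarrow> (\<forall>x. A (B x) = B (A x)) \<longrightarrow> (\<forall>x. X (B x) = B (X x)))"
proof -
  let ?Y = "sqrt_iter A" and ?y = sqrt_iter_real
  have bc: "bounded_clinear (?Y n)" for n by (rule sqrt_iter_bounded_clinear[OF A(1)])
  have norm_le: "norm (?Y n x) \<le> norm x" for n x
    using sqrt_iter_norm_le[OF le, of n x] sqrt_iter_real_bounds[of n]
      mult_right_mono[of "?y n" 1 "norm x"] by simp
  have "convergent (\<lambda>n. ?Y n x)" for x
  proof -
    \<comment> \<open>The scalar steps telescope to \<open>?y n\<close>, which is at most 1, and
      they dominate the operator steps.\<close>
    have "summable (\<lambda>n. (?y (Suc n) - ?y n) * norm x)"
    proof (intro summable_mult2 summableI_nonneg_bounded[where x = 1])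
      fix n
      show "0 \<le> ?y (Suc n) - ?y n" using sqrt_iter_real_mono[of n] by simp
      show "(\<Sum>i<n. ?y (Suc i) - ?y i) \<le> 1"
        using sqrt_iter_real_bounds[of n] by (simp only: sum_lessThan_telescope) simp
    qed
    then have "summable (\<lambda>n. ?Y (Suc n) x - ?Y n x)"
      by (rule summable_comparison_test') (rule sqrt_iter_step_le[OF A(1) le])
    then have "convergent (\<lambda>n. \<Sum>i<n. ?Y (Suc i) x - ?Y i x)" by (simp add: summable_iff_convergent)
    then show ?thesis
      by (simp only: sum_lessThan_telescope[of "\<lambda>i. ?Y i x"]) simp
  qed
  then have "\<forall>x. \<exists>l. (\<lambda>n. ?Y n x) \<longlonglongrightarrow> l" by (simp add: convergent_def)
  from choice[OF this] obtain Y where Y: "\<And>x. (\<lambda>n. ?Y n x) \<longlonglongrightarrow> Y x" by blast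
  have Y_norm: "norm (Y x) \<le> norm x" for x
    by (rule LIMSEQ_le_const2[OF tendsto_norm[OF Y]]) (use norm_le in blast)
  have Y_commute: "Y (B x) = B (Y x)"
    if B: "bounded_clinear B" "\<And>x. A (B x) = B (A x)" for B x
  proof (rule LIMSEQ_unique[OF Y])
    show "(\<lambda>n. ?Y n (B x)) \<longlonglongrightarrow> B (Y x)"
      unfolding sqrt_iter_commute[where A = A and B = B, OF B]
      by (rule bounded_linear.tendsto[OF bounded_clinear_imp_bounded_linear[OF B(1)] Y])
  qed
  have Y_bc: "bounded_clinear Y"
  proof (rule bounded_clinearI[where K = 1])
    show "Y (x + z) = Y x + Y z" for x z
      using tendsto_add[OF Y[of x] Y[of z]] Y[of "x + z"]
      by (simp add: bounded_clinear_simps[OF bc] LIMSEQ_unique)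
    \<comment> \<open>Multiplication by \<open>a\<close> is itself a bounded operator commuting with
      \<open>A\<close>.\<close>
    show "Y (a *\<^sub>C x) = a *\<^sub>C Y x" for a x
      by (rule Y_commute)
        (auto intro!: bounded_clinearI[where K = "cmod a"]
          simp: scaleC_add_right scaleC_scaleC norm_scaleC mult.commute bounded_clinear_scaleC[OF A(1)])
  qed (simp add: Y_norm)
  have clim: "(\<lambda>n. cinner (?Y n x) z) \<longlonglongrightarrow> cinner (Y x) z" for x z
  proof -
    have "bounded_linear (\<lambda>x. cinner x z)"
      by (rule bounded_linear_intro[where K = "norm z"])
        (simp_all add: cinner_simps cinner_norm_le scaleR_conv_of_real)
    from bounded_linear.tendsto[OF this Y] show ?thesis .
  qed
  have Y_adj: "adjoint_pair Y Y"
    unfolding adjoint_pair_def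
  proof (intro allI LIMSEQ_unique[OF clim])
    fix x z
    have "(\<lambda>n. cnj (cinner (?Y n z) x)) \<longlonglongrightarrow> cnj (cinner (Y z) x)"
      by (intro tendsto_cnj clim)
    then show "(\<lambda>n. cinner (?Y n x) z) \<longlonglongrightarrow> cinner x (Y z)"
      by (simp only: cinner_commute[symmetric] adjoint_pairD[OF sqrt_iter_selfadjoint[OF A(2)]])
  qed
  have "(\<lambda>n. ?Y n (?Y n x)) \<longlonglongrightarrow> Y (Y x)" for x
  proof -
    \<comment> \<open>Convergence is only pointwise, so the product is split as
      \<open>?Y n (?Y n x - Y x) + ?Y n (Y x)\<close>, with the uniform bound \<open>norm_le\<close>
      for the first summand.\<close>
    have "(\<lambda>n. ?Y n (?Y n x - Y x)) \<longlonglongrightarrow> 0"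
    proof (rule Lim_null_comparison)
      show "\<forall>\<^sub>F n in sequentially. norm (?Y n (?Y n x - Y x)) \<le> norm (?Y n x - Y x)"
        using norm_le by simp
      show "(\<lambda>n. norm (?Y n x - Y x)) \<longlonglongrightarrow> 0"
        using Y by (simp add: LIM_zero tendsto_norm_zero)
    qed
    from tendsto_add[OF this Y[of "Y x"]] show ?thesis
      by (simp add: bounded_clinear_simps[OF bc])
  qed
  from tendsto_scaleR[OF tendsto_const tendsto_add[OF tendsto_const this]]
  have "(\<lambda>n. ?Y (Suc n) x) \<longlonglongrightarrow> (1/2) *\<^sub>R (A x + Y (Y x))" for x by simp
  from LIMSEQ_unique[OF LIMSEQ_Suc[OF Y] this]
  have YY: "Y x = (1/2) *\<^sub>R (A x + Y (Y x))" for x .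
  have "2 *\<^sub>R Y x = A x + Y (Y x)" for x
    using arg_cong[OF YY[of x], of "\<lambda>v. 2 *\<^sub>R v"] by simp
  then have YY': "Y (Y x) = 2 *\<^sub>R Y x - A x" for x by simp
  show ?thesis
  \<comment> \<open>The fixed point equation \<open>2 Y = A + Y^2\<close> gives
    \<open>(1 - Y)^2 = 1 - A\<close>.\<close>
  proof (intro exI[of _ "\<lambda>x. x - Y x"] conjI allI impI)
    show "bounded_clinear (\<lambda>x. x - Y x)" by (rule bounded_clinear_diff[OF bounded_clinear_id Y_bc])
    show "adjoint_pair (\<lambda>x. x - Y x) (\<lambda>x. x - Y x)"
      using Y_adj by (simp add: adjoint_pair_def cinner_simps)
    show "x - Y x - Y (x - Y x) = x - A x" for x
      by (simp add: bounded_clinear_simps[OF Y_bc] YY' scaleR_2)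
    fix B :: "'a \<Rightarrow> 'a" and x
    assume B: "bounded_clinear B" "\<forall>x. A (B x) = B (A x)"
    have "Y (B x) = B (Y x)" by (rule Y_commute[OF B(1)]) (use B(2) in blast)
    then show "B x - Y (B x) = B (x - Y x)" by (simp add: bounded_clinear_simps[OF B(1)])
  qed
qed


section \<open>Block operators on the first two coordinates\<close>

lift_definition ell2_single :: "nat \<Rightarrow> 'a :: complex_inner \<Rightarrow> 'a ell2" is "\<lambda>i x n. if n = i then x else 0"
  by (rule summable_finite[of "{i}" for i]) auto

text \<open>The tail is kept rather than annihilated: this allows invertibility on the whole space
  and puts the tail into the summand where the diagonal is 1.\<close>

lift_definition block_op ::
  "('a :: complex_inner \<Rightarrow> 'a) \<Rightarrow> ('a \<Rightarrow> 'a) \<Rightarrow> ('a \<Rightarrow> 'a) \<Rightarrow> ('a \<Rightarrow> 'a) \<Rightarrow> 'a ell2 \<Rightarrow> 'a ell2"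
  is "\<lambda>A B C D x n. if n = 0 then A (x 0) + B (x 1) else if n = 1 then C (x 0) + D (x 1) else x n"
proof -
  fix A B C D :: "'a \<Rightarrow> 'a" and x :: "nat \<Rightarrow> 'a"
  assume "summable (\<lambda>n. (norm (x n))\<^sup>2)"
  then show "summable (\<lambda>n. (norm (if n = 0 then A (x 0) + B (x 1) else if n = 1 then C (x 0) + D (x 1)
      else x n))\<^sup>2)"
    by (rule summable_cong[THEN iffD1, rotated]) (auto simp: eventually_sequentially intro!: exI[of _ 2])
qed

lemma ell2_eqI: "(\<And>n. ell2_nth x n = ell2_nth y n) \<Longrightarrow> x = y"
  by (simp add: ell2_nth_inject[symmetric] fun_eq_iff)

lemmas ell2_nth_simps = plus_ell2.rep_eq minus_ell2.rep_eq scaleR_ell2.rep_eq scaleC_ell2.rep_eq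
  zero_ell2.rep_eq ell2_single.rep_eq block_op.rep_eq

lemma cinner_ell2_split:
  "cinner x y = cinner (ell2_nth x 0) (ell2_nth y 0) + cinner (ell2_nth x 1) (ell2_nth y 1)
    + (\<Sum>n. cinner (ell2_nth x (n + 2)) (ell2_nth y (n + 2)))"
  unfolding cinner_ell2_def
  by (subst suminf_split_initial_segment[OF summable_cinner_ell2, of _ _ 2])
    (simp add: numeral_2_eq_2)

lemma summable_ell2_shift: "summable (\<lambda>n. cinner (ell2_nth x (n + k)) (ell2_nth y (n + k)))"
  by (rule summable_ignore_initial_segment[OF summable_cinner_ell2])

lemma bounded_clinear_ell2_nth: "bounded_clinear (\<lambda>x :: 'a :: complex_inner ell2. ell2_nth x n)"
  by (rule bounded_clinearI[where K = 1]) (simp_all add: ell2_nth_simps norm_ell2_nth_le)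

lemma norm_ell2_single: "norm (ell2_single i (x :: 'a :: complex_inner)) = norm x"
proof -
  have "(norm (ell2_single i x))\<^sup>2 = (\<Sum>n. if n = i then (norm x)\<^sup>2 else 0)"
    unfolding norm_ell2_sq by (rule suminf_cong) (simp add: ell2_nth_simps)
  also have "\<dots> = (norm x)\<^sup>2" using sums_single[of i "\<lambda>_. (norm x)\<^sup>2"] by (simp add: sums_iff)
  finally show ?thesis by (simp add: power2_eq_iff_nonneg)
qed

lemma bounded_clinear_single: "bounded_clinear (ell2_single i :: 'a :: complex_inner \<Rightarrow> 'a ell2)"
  by (intro bounded_clinearI[where K = 1] ell2_eqI) (simp_all add: ell2_nth_simps norm_ell2_single)

lemma isometric_embedding_single: "isometric_embedding (ell2_single 0 :: 'a :: complex_inner \<Rightarrow> 'a ell2)"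
  unfolding isometric_embedding_def
proof (intro conjI allI bounded_clinear_single)
  show "cinner (ell2_single 0 x) (ell2_single 0 y) = cinner x y" for x y :: 'a
    by (simp add: cinner_ell2_split ell2_nth_simps)
qed

lemma bounded_clinear_block_op:
  assumes "bounded_clinear A" "bounded_clinear B" "bounded_clinear C" "bounded_clinear D"
  shows "bounded_clinear (block_op A B C D)"
proof -
  let ?p = "\<lambda>n x. ell2_nth x n"
  have comp: "bounded_clinear (\<lambda>x. F (?p n x))" if "bounded_clinear F" for n and F :: "'a \<Rightarrow> 'a"
    by (rule bounded_clinear_compose[OF that bounded_clinear_ell2_nth])
  have single: "bounded_clinear (\<lambda>x. ell2_single i (F x))" if "bounded_clinear F"
    for i and F :: "'a ell2 \<Rightarrow> 'a"
    by (rule bounded_clinear_compose[OF bounded_clinear_single that])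
  \<comment> \<open>As the identity corrected in two coordinates, the operator inherits boundedness
    from finitely many summands.\<close>
  have "block_op A B C D = (\<lambda>x. x + ell2_single 0 (A (?p 0 x) + B (?p 1 x) - ?p 0 x)
      + ell2_single 1 (C (?p 0 x) + D (?p 1 x) - ?p 1 x))"
    by (rule ext, rule ell2_eqI) (simp add: ell2_nth_simps)
  moreover have "bounded_clinear \<dots>"
    by (intro bounded_clinear_add bounded_clinear_diff bounded_clinear_id single comp assms
        bounded_clinear_ell2_nth)
  ultimately show ?thesis by simp
qed


section \<open>Construction of the dilation\<close>

text \<open>\<open>quad\<close> says \<open>(D - 1) (D - r) = 0\<close>, so the space splits
  algebraically into two eigenspaces of \<open>D\<close>. \<open>JD\<close> says
  \<open>J* J = D^2\<close>, so \<open>J\<close> times the inverse of \<open>D\<close> preserves the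
  form.\<close>

lemma unitary_diag_formI:
  fixes J D :: "'a :: complex_inner \<Rightarrow> 'a"
  assumes r: "0 < r" "r < 1"
    and J: "bounded_clinear J" "surj J" and D: "bounded_clinear D" "adjoint_pair D D"
    and quad: "\<And>x. D (D x) = (1 + r) *\<^sub>R D x - r *\<^sub>R x"
    and JD: "\<And>x y. cinner (J x) (J y) = cinner (D x) (D y)"
  shows "unitary_diag_form r J"
proof -
  define K0 where "K0 = {x. D x = r *\<^sub>R x}"
  define K1 where "K1 = {x. D x = x}"
  \<comment> \<open>The inverse of \<open>D\<close>, read off from
    \<open>D ((1 + r) - D) = r\<close>.\<close>
  define E where "E x = (1 / r) *\<^sub>R ((1 + r) *\<^sub>R x - D x)" for x
  note simps = bounded_clinear_simps[OF D(1)] bounded_clinear_scaleC[OF D(1)]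
  have cont: "continuous_on UNIV D"
    by (rule linear_continuous_on[OF bounded_clinear_imp_bounded_linear[OF D(1)]])
  have cl: "closed K0" "closed K1"
    unfolding K0_def K1_def by (intro closed_Collect_eq cont continuous_intros)+
  have sub: "csubspace K0" "csubspace K1"
    by (auto simp: csubspace_def K0_def K1_def simps scaleR_add_right scaleC_scaleR_commute)
  have orth: "cinner x y = 0" if "x \<in> K0" "y \<in> K1" for x y
  proof -
    have "r * cinner x y = cinner x y"
      using adjoint_pairD[OF D(2), of x y] that by (simp add: K0_def K1_def cinner_scaleR_left)
    then show ?thesis using r by auto
  qed
  \<comment> \<open>\<open>P\<close> and \<open>Q\<close> are the Lagrange polynomials in
    \<open>D\<close> for the eigenvalues \<open>r\<close> and 1, hence the projections onto
    \<open>K0\<close> and \<open>K1\<close>.\<close>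
  define P where "P z = (1 / (1 - r)) *\<^sub>R (z - D z)" for z
  define Q where "Q z = (1 / (1 - r)) *\<^sub>R (D z - r *\<^sub>R z)" for z
  have P: "P z \<in> K0" for z
  proof -
    have "D (z - D z) = r *\<^sub>R (z - D z)" by (simp add: simps quad algebra_simps)
    then show ?thesis unfolding K0_def P_def by (simp only: mem_Collect_eq simps) (simp add: mult.commute)
  qed
  have Q: "Q z \<in> K1" for z
  proof -
    have "D (D z - r *\<^sub>R z) = D z - r *\<^sub>R z" by (simp add: simps quad algebra_simps)
    then show ?thesis unfolding K1_def Q_def by (simp only: mem_Collect_eq simps)
  qed
  have PQ: "P z + Q z = z" for z
  proof -
    have "P z + Q z = (1 / (1 - r)) *\<^sub>R ((1 - r) *\<^sub>R z)"
      unfolding P_def Q_def scaleR_add_right[symmetric] by (simp add: algebra_simps)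
    then show ?thesis using r by simp
  qed
  have rPQ: "r *\<^sub>R P z + Q z = D z" for z
  proof -
    have "r *\<^sub>R P z + Q z = (1 / (1 - r)) *\<^sub>R ((1 - r) *\<^sub>R D z)"
      unfolding P_def Q_def scaleR_left_commute[of r] scaleR_add_right[symmetric]
      by (simp add: algebra_simps)
    then show ?thesis using r by simp
  qed
  have dec: "orth_decomp K0 K1"
    unfolding orth_decomp_def using cl sub orth P Q PQ by (metis (no_types))
  have diag: "diag_op K0 K1 r 1 z = D z" for z
    using orth_decomp_proj[OF dec P Q, of z z] by (simp add: diag_op_def PQ rPQ)
  have DE: "D (E x) = x" and ED: "E (D x) = x" for x
    using r by (simp_all add: E_def simps quad)
  have "bounded_clinear E"
    unfolding E_def[abs_def] by (intro bounded_clinear_intros D(1))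
  from bounded_clinear_compose[OF J(1) this] have "isometric_embedding (\<lambda>x. J (E x))"
    by (simp add: isometric_embedding_def JD DE)
  moreover have "surj (\<lambda>x. J (E x))"
    unfolding surj_def using J(2) ED by (metis surjD)
  moreover have "J = (\<lambda>x. J (E x)) \<circ> diag_op K0 K1 r 1"
    by (simp add: fun_eq_iff diag ED)
  ultimately show ?thesis unfolding unitary_diag_form_def unitary_op_def using dec by blast
qed

text \<open>The intertwining relation passes to the inverses, so all integer powers of
  \<open>J\<close> map the range of \<open>V\<close> into itself, where the projection acts as the
  identity.\<close>

lemma power_dilationI:
  fixes V :: "'a :: complex_hilbert \<Rightarrow> 'b :: complex_inner"
  assumes V: "isometric_embedding V" and T: "invertible_op T" and J: "invertible_op J"
    and JV: "\<And>x. J (V x) = V (T x)"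
  shows "power_dilation V J T"
proof -
  have "inv J (V x) = V (inv T x)" for x
  proof (rule inv_f_eq)
    show "inj J" by (rule bij_is_inj[OF invertible_op_bij[OF J]])
    show "J (V (inv T x)) = V x"
      using invertible_op_bij[OF T] by (simp add: JV bij_is_surj surj_f_inv_f)
  qed
  then have "(inv J ^^ n) (V x) = V ((inv T ^^ n) x)" "(J ^^ n) (V x) = V ((T ^^ n) x)" for n x
    using JV by (induction n) auto
  then have "op_powi J n (V x) = V (op_powi T n x)" for n x by (simp add: op_powi_def)
  moreover have "orth_proj (range V) (V x) = V x" for x
    by (rule orth_proj_unique[OF isometric_embedding_range(1)[OF V]]) auto
  ultimately show ?thesis using V J by (simp add: power_dilation_def)
qed

lemma class_C1_imp_dilation:
  fixes T :: "'h :: complex_hilbert \<Rightarrow> 'h"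
  assumes r: "0 < r" "r < 1" and T: "invertible_op T" and C: "T \<in> class_C1 r"
  shows "\<exists>(V :: 'h \<Rightarrow> 'h ell2) J. power_dilation V J T \<and> unitary_diag_form r J"
proof -
  define Ti where "Ti = inv T"
  have bT: "bounded_clinear T" using T by (simp add: invertible_op_def)
  have bTi: "bounded_clinear Ti" unfolding Ti_def by (rule invertible_op_inv[OF T])
  have TTi [simp]: "T (Ti x) = x" and TiT [simp]: "Ti (T x) = x" for x
    using invertible_op_bij[OF T]
    by (simp_all add: Ti_def bij_is_surj surj_f_inv_f bij_is_inj inv_f_f)
  have le1: "norm (T x) \<le> norm x" and le2: "r * norm (Ti x) \<le> norm x" for x
    using C by (simp_all add: class_C1_iff[OF r(1) T] Ti_def)

  \<comment> \<open>Adjoints and the operator \<open>S = T* T\<close>\<close>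
  obtain Ts where Ts: "bounded_clinear Ts" "adjoint_pair T Ts" by (rule adjoint_exists[OF bT])
  \<comment> \<open>\<open>L\<close> is also the inverse of \<open>Ts\<close>, so
    \<open>Ti L\<close> is the inverse of \<open>S\<close>.\<close>
  obtain L where L: "bounded_clinear L" "adjoint_pair Ti L" by (rule adjoint_exists[OF bTi])
  note adj = adjoint_pairD'[OF Ts(2)] adjoint_pairD'[OF L(2)]
  have TsL [simp]: "Ts (L x) = x" and LTs [simp]: "L (Ts x) = x" for x
    by (rule cinner_ext, simp add: adj)+
  define S where "S x = Ts (T x)" for x
  have bS: "bounded_clinear S" unfolding S_def[abs_def] by (rule bounded_clinear_compose[OF Ts(1) bT])
  have sS: "adjoint_pair S S"
    by (simp add: adjoint_pair_def S_def adj adjoint_pairD[OF Ts(2)])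
  note S = bounded_clinear_simps[OF bS]

  text \<open>Centring \<open>S\<close> at the midpoint of \<open>[r\<^sup>2, 1]\<close> makes \<open>(1 - S) (S - r\<^sup>2)\<close> a constant minus a square.\<close>
  define m where "m = (1 + r\<^sup>2) / 2"
  define \<rho> where "\<rho> = (1 - r\<^sup>2) / 2"
  define M where "M x = S x - m *\<^sub>R x" for x
  have "r\<^sup>2 \<le> 1" using r by (simp add: power_le_one)
  then have "0 \<le> \<rho>" by (simp add: \<rho>_def)
  moreover have "\<rho> \<le> 1"
    using order_trans[OF _ zero_le_power2[of r], of "-1"] by (simp add: \<rho>_def)
  ultimately have \<rho>: "0 \<le> \<rho>" "\<rho>\<^sup>2 \<le> 1" by (simp_all add: power_le_one)
  have bM: "bounded_clinear M" unfolding M_def[abs_def] by (intro bounded_clinear_intros bS)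
  have sM: "adjoint_pair M M" using sS by (simp add: adjoint_pair_def M_def cinner_simps)
  \<comment> \<open>The bounds on \<open>T\<close> and \<open>Ti\<close> place the form of
    \<open>S\<close> between \<open>r^2\<close> and 1; after centring it is bounded by
    \<open>\<rho>\<close>.\<close>
  have M_le: "norm (M x) \<le> \<rho> * norm x" for x
  proof (rule selfadjoint_norm_le[OF bM sM])
    fix x
    have "inner (S x) x = (norm (T x))\<^sup>2"
      by (simp add: inner_Re_cinner S_def adj power2_norm_eq_inner)
    then have "inner (M x) x = (norm (T x))\<^sup>2 - m * (norm x)\<^sup>2"
      by (simp add: M_def inner_diff_left power2_norm_eq_inner)
    moreover have "(norm (T x))\<^sup>2 \<le> (norm x)\<^sup>2" using le1 by (simp add: power_mono)
    moreover have "r\<^sup>2 * (norm x)\<^sup>2 \<le> (norm (T x))\<^sup>2"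
      unfolding power_mult_distrib[symmetric] using le2[of "T x"] r by (intro power_mono) simp_all
    moreover have "m * (norm x)\<^sup>2 = ((norm x)\<^sup>2 + r\<^sup>2 * (norm x)\<^sup>2) / 2"
      "\<rho> * (norm x)\<^sup>2 = ((norm x)\<^sup>2 - r\<^sup>2 * (norm x)\<^sup>2) / 2"
      by (simp_all add: m_def \<rho>_def field_simps)
    ultimately show "\<bar>inner (M x) x\<bar> \<le> \<rho> * (norm x)\<^sup>2" by argo
  qed
  \<comment> \<open>Chosen so that \<open>1 - A = \<rho>^2 - M^2 = (1 - S) (S - r^2)\<close>; the
    bounds on \<open>\<rho>\<close> and \<open>M\<close> make \<open>A\<close> a
    contraction.\<close>
  define A where "A x = (1 - \<rho>\<^sup>2) *\<^sub>R x + M (M x)" for x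
  have bA: "bounded_clinear A"
    unfolding A_def[abs_def] using bounded_clinear_compose[OF bM bM]
    by (intro bounded_clinear_intros)
  have sA: "adjoint_pair A A"
    by (simp add: adjoint_pair_def A_def cinner_simps adjoint_pairD[OF sM])
  have A_le: "norm (A x) \<le> norm x" for x
  proof -
    have "norm (M (M x)) \<le> \<rho> * (\<rho> * norm x)"
      using M_le[of "M x"] mult_left_mono[OF M_le[of x] \<rho>(1)] by linarith
    then have "norm (A x) \<le> \<bar>1 - \<rho>\<^sup>2\<bar> * norm x + \<rho>\<^sup>2 * norm x"
      unfolding A_def by (intro order_trans[OF norm_triangle_ineq]) (simp add: power2_eq_square)
    then show ?thesis using \<rho>(2) by (simp add: algebra_simps)
  qed
  have AS: "A (S x) = S (A x)" for x by (simp add: A_def M_def S)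
  obtain X where bX: "bounded_clinear X" and sX: "adjoint_pair X X"
    and XX: "\<And>x. X (X x) = x - A x" and XS: "\<And>x. X (S x) = S (X x)"
    using sqrt_one_minus_exists[OF bA sA A_le] bS AS by metis
  note X = bounded_clinear_simps[OF bX]
  have XX': "X (X x) = (1 + r\<^sup>2) *\<^sub>R S x - S (S x) - r\<^sup>2 *\<^sub>R x" for x
  proof -
    have mm: "m + m = 1 + r\<^sup>2" and \<rho>m: "\<rho>\<^sup>2 - m * m = - r\<^sup>2"
      by (simp_all add: m_def \<rho>_def power2_eq_square field_simps)
    have "X (X x) = m *\<^sub>R S x + m *\<^sub>R S x - S (S x) + (\<rho>\<^sup>2 - m * m) *\<^sub>R x"
      unfolding XX A_def M_def S by (simp add: algebra_simps)
    then show ?thesis unfolding scaleR_add_left[symmetric] mm \<rho>m by simp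
  qed

  define J where "J = block_op T (\<lambda>x. L (X x)) (\<lambda>_. 0) (\<lambda>x. r *\<^sub>R L x)"
  \<comment> \<open>The inverse of the upper triangular block matrix, since \<open>r L\<close> has
    inverse \<open>Ts / r\<close>.\<close>
  define J' where
    "J' = block_op Ti (\<lambda>x. - (1 / r) *\<^sub>R Ti (L (X (Ts x)))) (\<lambda>_. 0) (\<lambda>x. (1 / r) *\<^sub>R Ts x)"
  \<comment> \<open>\<open>J* J\<close> has blocks \<open>[[S, X], [X, 1 + r^2 - S]]\<close>. If
    \<open>D^2 = J* J\<close> and \<open>D^2 = (1 + r) D - r\<close>, then \<open>D\<close> must be
    \<open>(J* J + r) / (1 + r)\<close>.\<close>
  define D where "D = block_op (\<lambda>x. (1 / (1 + r)) *\<^sub>R (S x + r *\<^sub>R x)) (\<lambda>x. (1 / (1 + r)) *\<^sub>R X x)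
    (\<lambda>x. (1 / (1 + r)) *\<^sub>R X x) (\<lambda>x. (1 / (1 + r)) *\<^sub>R ((1 + r + r\<^sup>2) *\<^sub>R x - S x))"
  have bLX: "bounded_clinear (\<lambda>x. L (X x))" by (rule bounded_clinear_compose[OF L(1) bX])
  have bJ: "bounded_clinear J" unfolding J_def
    by (intro bounded_clinear_block_op bT bLX bounded_clinear_zero bounded_clinear_scaleR L(1))
  have bJ': "bounded_clinear J'" unfolding J'_def
    by (intro bounded_clinear_block_op bTi bounded_clinear_zero bounded_clinear_scaleR Ts(1)
        bounded_clinear_compose[OF bTi] bounded_clinear_compose[OF bLX Ts(1)])
  have JJ': "J (J' x) = x" and J'J: "J' (J x) = x" for x
    using r by (auto intro!: ell2_eqI simp: J_def J'_def ell2_nth_simps bounded_clinear_simps[OF bT]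
        bounded_clinear_simps[OF bTi] bounded_clinear_simps[OF Ts(1)] bounded_clinear_simps[OF L(1)] X)
  have cancel: "(1 + r) *\<^sub>R (1 / (1 + r)) *\<^sub>R x = x" for x :: 'h using r by simp
  \<comment> \<open>Denominators are cleared, leaving identities polynomial in \<open>r\<close>,
    \<open>S\<close> and \<open>X\<close>.\<close>
  have D0: "(1 + r) *\<^sub>R ell2_nth (D x) 0 = S (ell2_nth x 0) + r *\<^sub>R ell2_nth x 0 + X (ell2_nth x 1)"
    and D1: "(1 + r) *\<^sub>R ell2_nth (D x) 1
      = X (ell2_nth x 0) + ((1 + r + r\<^sup>2) *\<^sub>R ell2_nth x 1 - S (ell2_nth x 1))"
    and D2: "n \<noteq> 0 \<Longrightarrow> n \<noteq> 1 \<Longrightarrow> ell2_nth (D x) n = ell2_nth x n" for x n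
    unfolding D_def by (simp_all add: ell2_nth_simps scaleR_add_right[of "1 + r"] cancel del: scaleR_scaleR)
  \<comment> \<open>Checked entrywise from \<open>X^2 = (1 - S) (S - r^2)\<close> and
    \<open>X S = S X\<close>; in the upper left corner
    \<open>(S + r)^2 + X^2 = (1 + r)^2 S\<close>.\<close>
  have DD: "D (D x) = (1 + r) *\<^sub>R D x - r *\<^sub>R x" for x
  proof (rule ell2_eqI)
    fix n :: nat
    let ?a = "ell2_nth x 0" and ?b = "ell2_nth x 1"
    have inj: "u = v" if "(1 + r) *\<^sub>R (1 + r) *\<^sub>R u = (1 + r) *\<^sub>R (1 + r) *\<^sub>R v" for u v :: 'h
      using that r by simp
    consider "n = 0" | "n = 1" | "n \<noteq> 0" "n \<noteq> 1" by blast
    then show "ell2_nth (D (D x)) n = ell2_nth ((1 + r) *\<^sub>R D x - r *\<^sub>R x) n"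
    proof cases
      case 1
      have "(1 + r) *\<^sub>R (1 + r) *\<^sub>R ell2_nth (D (D x)) 0
          = S ((1 + r) *\<^sub>R ell2_nth (D x) 0) + r *\<^sub>R (1 + r) *\<^sub>R ell2_nth (D x) 0
            + X ((1 + r) *\<^sub>R ell2_nth (D x) 1)"
        unfolding D0[of "D x"] S X by (simp only: scaleR_add_right scaleR_left_commute)
      also have "\<dots> = (1 + r) *\<^sub>R (1 + r) *\<^sub>R ((1 + r) *\<^sub>R ell2_nth (D x) 0 - r *\<^sub>R ?a)"
        unfolding D0 D1 S X XX' XS by (simp add: algebra_simps power2_eq_square)
      finally show ?thesis using 1 by (simp only: ell2_nth_simps inj)
    next
      case 2
      have "(1 + r) *\<^sub>R (1 + r) *\<^sub>R ell2_nth (D (D x)) 1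
          = X ((1 + r) *\<^sub>R ell2_nth (D x) 0) + ((1 + r + r\<^sup>2) *\<^sub>R (1 + r) *\<^sub>R ell2_nth (D x) 1
            - S ((1 + r) *\<^sub>R ell2_nth (D x) 1))"
        unfolding D1[of "D x"] S X by (simp only: scaleR_add_right scaleR_diff_right scaleR_left_commute)
      also have "\<dots> = (1 + r) *\<^sub>R (1 + r) *\<^sub>R ((1 + r) *\<^sub>R ell2_nth (D x) 1 - r *\<^sub>R ?b)"
        unfolding D0 D1 S X XX' XS by (simp add: algebra_simps power2_eq_square)
      finally show ?thesis using 2 by (simp only: ell2_nth_simps inj)
    next
      case 3
      then show ?thesis by (simp add: D2 ell2_nth_simps algebra_simps)
    qed
  qed

  \<comment> \<open>Verification of the dilation and of the unitary-diagonal form\<close>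
  have J: "invertible_op J"
    unfolding invertible_op_def using bJ bJ' JJ' J'J by (auto simp: fun_eq_iff)
  have "power_dilation (ell2_single 0) J T"
    by (rule power_dilationI[OF isometric_embedding_single T J])
      (auto intro!: ell2_eqI simp: J_def ell2_nth_simps X bounded_clinear_simps[OF L(1)])
  moreover have "unitary_diag_form r J"
  proof (rule unitary_diag_formI[OF r bJ _ _ _ _])
    show "surj J" using JJ' by (metis surjI)
    show bD: "bounded_clinear D" unfolding D_def
      by (intro bounded_clinear_block_op bounded_clinear_scaleR bounded_clinear_add
          bounded_clinear_diff bounded_clinear_id bS bX)
    show sD: "adjoint_pair D D"
      by (simp add: adjoint_pair_def D_def cinner_ell2_split[of "block_op _ _ _ _ _"]
          cinner_ell2_split[of _ "block_op _ _ _ _ _"] ell2_nth_simps cinner_simps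
          adjoint_pairD[OF sS] adjoint_pairD[OF sX] algebra_simps)
    show "D (D x) = (1 + r) *\<^sub>R D x - r *\<^sub>R x" for x by (rule DD)
    \<comment> \<open>Computes \<open>J* J\<close> blockwise, identifies it with
      \<open>(1 + r) D - r\<close>, and this with \<open>D^2\<close> by \<open>DD\<close>.\<close>
    show "cinner (J x) (J y) = cinner (D x) (D y)" for x y
    proof -
      let ?a = "ell2_nth x 0" and ?b = "ell2_nth x 1" and ?c = "ell2_nth y 0" and ?d = "ell2_nth y 1"
      let ?t = "\<Sum>n. cinner (ell2_nth x (n + 2)) (ell2_nth y (n + 2))"
      \<comment> \<open>\<open>D0\<close> and \<open>D1\<close> carry the factor
        \<open>1 + r\<close>, so the tail is put in the same form.\<close>
      have tail: "(\<Sum>n. cinner ((1 + r) *\<^sub>R ell2_nth (D x) (n + 2)) (ell2_nth y (n + 2)))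
          = complex_of_real (1 + r) * ?t"
        unfolding cinner_scaleR_left by (simp add: D2 suminf_mult[OF summable_ell2_shift[where k = 2, simplified]])
      have TL: "cinner (T u) (L v) = cinner u v" for u v
        by (simp add: adjoint_pairD[OF L(2), symmetric])
      have TiLS: "Ti (L (S u)) = u" for u by (simp add: S_def)
      have TiLX: "Ti (L (X u)) = X (Ti (L u))" for u
        using XS[of "Ti (L u)"] TiLS by (simp add: S_def)
      \<comment> \<open>With \<open>Ti L\<close> the inverse of \<open>S\<close>, this is
        \<open>X^2\<close> divided by \<open>S\<close>. Its last term cancels the contribution of
        the lower right block \<open>r L\<close> of \<open>J\<close>.\<close>
      have TiLXX: "X (Ti (L (X u))) = (1 + r\<^sup>2) *\<^sub>R u - S u - r\<^sup>2 *\<^sub>R Ti (L u)" for u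
        unfolding TiLX XX' by (simp add: S_def)
      have "cinner (J x) (J y) = cinner (T ?a + L (X ?b)) (T ?c + L (X ?d)) 
          + r\<^sup>2 * cinner (L ?b) (L ?d) + ?t"
        by (subst cinner_ell2_split) (simp add: J_def ell2_nth_simps cinner_simps power2_eq_square)
      also have "cinner (L ?b) (L ?d) = cinner (Ti (L ?b)) ?d"
        by (simp add: adjoint_pairD[OF L(2)])
      also have "cinner (T ?a + L (X ?b)) (T ?c + L (X ?d))
          = cinner (S ?a + X ?b) ?c + cinner (X ?a + X (Ti (L (X ?b)))) ?d"
        by (simp add: cinner_simps S_def adj TL adjoint_pairD[OF L(2)] adjoint_pairD[OF sX])
      also have "\<dots> + r\<^sup>2 * cinner (Ti (L ?b)) ?d + ?t
          = cinner (S ?a + X ?b) ?c + cinner (X ?a + ((1 + r\<^sup>2) *\<^sub>R ?b - S ?b)) ?d + ?t"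
        unfolding TiLXX by (simp add: cinner_simps)
      also have "\<dots> = cinner ((1 + r) *\<^sub>R D x) y - r * cinner x y"
        unfolding cinner_ell2_split[of _ y] scaleR_ell2.rep_eq D0 D1 tail
        by (simp add: cinner_simps algebra_simps)
      also have "\<dots> = cinner (D (D x)) y" by (simp add: DD cinner_simps)
      also have "\<dots> = cinner (D x) (D y)" by (rule adjoint_pairD[OF sD])
      finally show ?thesis .
    qed
  qed
  ultimately show ?thesis by blast
qed

text \<open>Existence is realized on the definite space \<open>'h ell2\<close>; the converse for an
  arbitrary dilation space \<open>'k\<close> makes the equivalence independent of that
  choice.\<close>

theorem theorem1p8:
  fixes T :: "'h :: complex_hilbert \<Rightarrow> 'h" and r :: real
  assumes "0 < r" and "r < 1" and "invertible_op T"
  shows "(T \<in> class_C1 r \<longleftrightarrow>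
           (\<exists>(V :: 'h \<Rightarrow> 'h ell2) J. power_dilation V J T \<and> unitary_diag_form r J)) \<and>
         ((\<exists>(V :: 'h \<Rightarrow> 'k :: complex_hilbert) J. power_dilation V J T \<and> unitary_diag_form r J)
           \<longrightarrow> T \<in> class_C1 r)"
proof (intro conjI iffI impI)
  show "\<exists>(V :: 'h \<Rightarrow> 'h ell2) J. power_dilation V J T \<and> unitary_diag_form r J"
    if "T \<in> class_C1 r"
    by (rule class_C1_imp_dilation[OF assms that])
qed (use dilation_imp_class_C1[OF assms] in blast)+

end
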